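(* Let $c$ be a fixed real number with $1<c<7/6$, and for $X>0$ put $$S_c(X)=\sum_{X/2<n\leq X}\mu^2([n^c])\,\mu^2([n^c]+1),$$ where $n$ runs over positive integers. Let $$\sigma=\prod_{p}\left(1-\frac{2}{p^2}\right),$$ the product being over all primes $p$. Then for every $\varepsilon>0$ the asymptotic formula $$S_c(X)=\frac{1}{2}\,\sigma X+\mathcal{O}\left(X^{\frac{6c+1}{8}+\varepsilon}\right)$$ holds for all sufficiently large $X$, where the implied constant may depend on $c$ and $\varepsilon$ but not on $X$.
   Context: Here $\mu$ is the Möbius function, so $\mu^2(m)=1$ if the positive integer $m$ is square-free and $\mu^2(m)=0$ otherwise; $[t]$ denotes the integer part (floor) of the real number $t$. Thus $S_c(X)$ counts the integers $n\in(X/2,X]$ for which $[n^c]$ and $[n^c]+1$ are both square-free. The letter $X$ denotes a sufficiently large positive real number, and $\varepsilon$ denotes an arbitrarily small positive number. *)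

theory Defs
  imports
    "HOL-Analysis.Analysis"
    "HOL-Computational_Algebra.Squarefree"
    "HOL-Library.Landau_Symbols"
begin

(* At 0 this returns the junk value 0, since 0 is not squarefree. *)
definition moebius_mu :: "nat \<Rightarrow> int" where
  "moebius_mu m = (if squarefree m then (-1) ^ card (prime_factors m) else 0)"

(* Truncation by nat is harmless: the floor is at least 1 for c > 0 and n > 0. *)
definition S :: "real \<Rightarrow> real \<Rightarrow> real" where
  "S c X = real_of_int (\<Sum>n | n > 0 \<and> X / 2 < real n \<and> real n \<le> X.
     (moebius_mu (nat \<lfloor>real n powr c\<rfloor>))\<^sup>2 * (moebius_mu (nat \<lfloor>real n powr c\<rfloor> + 1))\<^sup>2)"

(* The product over the primes is indexed by all naturals, with factor 1 at non-primes. *)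
definition sigma_const :: real where
  "sigma_const = (\<Prod>p. if prime p then 1 - 2 / (real p)\<^sup>2 else 1)"

end

theory Submission
  imports Defs "HOL-Number_Theory.Cong"
begin

text \<open>Write \<open>\<theta> = (6 * c + 1) / 8\<close> and \<open>z = X powr (c - \<theta>)\<close>. The indicator of m and \<open>m + 1\<close> being
  square-free is the sum of \<open>\<mu>(d)\<close> over \<open>d\<^sup>2\<close> dividing \<open>m * (m + 1)\<close>.

  For \<open>d > z\<close> one forgets that m is of the form \<open>[n^c]\<close>: up to a factor \<open>X\<^sup>\<epsilon>\<close>, the number of
  \<open>m \<le> X\<^sup>c\<close> with such a d is at most \<open>X\<^sup>c / z = X\<^sup>\<theta>\<close>.

  For \<open>d \<le> z\<close> the n with \<open>[n^c]\<close> in a given residue class modulo \<open>d\<^sup>2\<close> are counted by sums of the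
  sawtooth function at \<open>n\<^sup>c / d\<^sup>2 + b\<close>. No exponential sums are needed: a Dirichlet
  approximation \<open>a / r\<close> to the derivative at n shows that over the next r terms the
  sequence is within \<open>O(1 / r)\<close> of a full set of multiples of \<open>1 / r\<close>, so the sawtooth sum over
  this block is \<open>O(1)\<close>, and since the derivative is increasing at a known rate only few blocks can
  share a given fraction \<open>a / r\<close>. With denominators up to \<open>X powr (3 / 4 - c / 2)\<close> this gives an
  error \<open>O(X powr (c / 2 + 1 / 4) * ln X)\<close> for each class, and z times it is again \<open>X\<^sup>\<theta>\<close>, up to \<open>X\<^sup>\<epsilon>\<close>.\<close>

section \<open>Sawtooth sums\<close>

text \<open>The value at integers is \<open>- 1 / 2\<close> rather than the customary 0, so that
  \<open>x = \<lfloor>x\<rfloor> + saw x + 1 / 2\<close> holds for every x.\<close>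

definition saw :: "real \<Rightarrow> real" where
  "saw x = frac x - 1 / 2"

lemma abs_saw_le: "\<bar>saw x\<bar> \<le> 1 / 2"
  using frac_lt_1[of x] frac_ge_0[of x] unfolding saw_def by linarith

text \<open>Multiplication by a permutes the residues modulo r, so the fractional parts are the
  numbers \<open>(j + t) / r\<close> with \<open>j < r\<close> and \<open>t = frac (r * b)\<close>.
  Hence the sum is exactly \<open>t - 1 / 2\<close>.\<close>

lemma abs_sum_saw_rational_le:
  fixes r :: nat and a :: int and b :: real
  assumes r: "r > 0" and cop: "coprime a (int r)"
  shows "\<bar>\<Sum>s<r. saw (b + of_int a * real s / real r)\<bar> \<le> 1 / 2"
proof -
  define k where "k = \<lfloor>real r * b\<rfloor>"
  define t where "t = frac (real r * b)"
  define m where "m s = nat ((k + a * int s) mod int r)" for s :: nat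
  have t: "0 \<le> t" "t < 1"
    unfolding t_def by (auto simp: frac_lt_1)
  have rb: "real r * b = of_int k + t"
    unfolding k_def t_def frac_def by simp
  have m_lt: "m s < r" for s
    unfolding m_def using r by (simp add: nat_less_iff)
  have "inj_on m {..<r}"
  proof (rule inj_onI)
    fix s s' assume s: "s \<in> {..<r}" "s' \<in> {..<r}" "m s = m s'"
    have "(k + a * int s) mod int r = (k + a * int s') mod int r"
      using s(3) r unfolding m_def by (simp add: nat_eq_iff)
    then have "[k + a * int s = k + a * int s'] (mod int r)"
      by (simp add: cong_def)
    then have "[a * int s = a * int s'] (mod int r)"
      using cong_add_lcancel by blast
    then have "[int s = int s'] (mod int r)"
      using cop cong_mult_lcancel by blast
    then show "s = s'"
      using s(1,2) by (simp add: cong_int_iff cong_less_modulus_unique_nat)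
  qed
  moreover have "m ` {..<r} \<subseteq> {..<r}"
    using m_lt by auto
  ultimately have bij: "bij_betw m {..<r} {..<r}"
    by (simp add: bij_betw_def endo_inj_surj)
  have fr: "frac (b + of_int a * real s / real r) = (real (m s) + t) / real r" for s
  proof -
    have "real_of_int (k + a * int s)
        = real r * of_int ((k + a * int s) div int r) + real (m s)"
    proof -
      have "k + a * int s = int r * ((k + a * int s) div int r) + int (m s)"
        using r unfolding m_def by simp
      then show ?thesis
        by (metis of_int_add of_int_mult of_int_of_nat_eq)
    qed
    then have "b + of_int a * real s / real r - (real (m s) + t) / real r
        = of_int ((k + a * int s) div int r)"
      using r rb by (simp add: field_simps)
    moreover have "(real (m s) + t) / real r < 1"
      using m_lt[of s] t r by (simp add: field_simps)
    ultimately show ?thesis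
      using t by (simp add: frac_unique_iff)
  qed
  have "(\<Sum>s<r. frac (b + of_int a * real s / real r)) = (\<Sum>s<r. (real (m s) + t) / real r)"
    by (simp add: fr)
  also have "\<dots> = (\<Sum>j<r. (real j + t) / real r)"
    by (rule sum.reindex_bij_betw[OF bij, of "\<lambda>j. (real j + t) / real r"])
  also have "\<dots> = ((\<Sum>j<r. real j) + real r * t) / real r"
    by (simp add: sum_divide_distrib[symmetric] sum.distrib)
  also have "(\<Sum>j<r. real j) = real r * (real r - 1) / 2"
    by (induction r) (auto simp: field_simps)
  also have "(real r * (real r - 1) / 2 + real r * t) / real r = (real r - 1) / 2 + t"
    using r by (simp add: field_simps)
  finally have "(\<Sum>s<r. saw (b + of_int a * real s / real r)) = t - 1 / 2"
    unfolding saw_def by (simp only: sum_subtractf) (simp add: field_simps)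
  with t show ?thesis
    by linarith
qed

text \<open>The floor is monotone, so shifting the rational points by the largest possible error
  sandwiches the perturbed sum between two exact ones.\<close>

lemma abs_sum_saw_near_rational_le:
  fixes r :: nat and a :: int and b K :: real and x :: "nat \<Rightarrow> real"
  assumes r: "r > 0" and cop: "coprime a (int r)"
    and x: "\<And>s. s < r \<Longrightarrow> \<bar>x s - (b + of_int a * real s / real r)\<bar> \<le> K / real r"
  shows "\<bar>\<Sum>s<r. saw (x s)\<bar> \<le> 1 / 2 + 2 * K"
proof -
  define y where "y s = b + of_int a * real s / real r" for s :: nat
  \<comment> \<open>Replacing \<open>x s\<close> by its leftmost possible position
    \<open>y s - K / r\<close> cannot raise the floor, and the linear part of \<open>saw\<close>
    moves by at most \<open>2 * K / r\<close>.\<close>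
  have up: "saw (x s) \<le> saw (y s - K / real r) + 2 * (K / real r)" if "s < r" for s
  proof -
    have "\<lfloor>y s - K / real r\<rfloor> \<le> \<lfloor>x s\<rfloor>"
      using x[OF that] unfolding y_def by (intro floor_mono) linarith
    then have "real_of_int \<lfloor>y s - K / real r\<rfloor> \<le> of_int \<lfloor>x s\<rfloor>"
      by simp
    with x[OF that] show ?thesis
      unfolding saw_def frac_def y_def[symmetric] by linarith
  qed
  have lo: "saw (y s + K / real r) - 2 * (K / real r) \<le> saw (x s)" if "s < r" for s
  proof -
    have "\<lfloor>x s\<rfloor> \<le> \<lfloor>y s + K / real r\<rfloor>"
      using x[OF that] unfolding y_def by (intro floor_mono) linarith
    then have "real_of_int \<lfloor>x s\<rfloor> \<le> of_int \<lfloor>y s + K / real r\<rfloor>"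
      by simp
    with x[OF that] show ?thesis
      unfolding saw_def frac_def y_def[symmetric] by linarith
  qed
  have "(\<Sum>s<r. saw (x s)) \<le> (\<Sum>s<r. saw (y s - K / real r) + 2 * (K / real r))"
    by (intro sum_mono up) auto
  also have "\<dots> = (\<Sum>s<r. saw ((b - K / real r) + of_int a * real s / real r)) + 2 * K"
    using r by (simp add: sum.distrib y_def algebra_simps)
  also have "\<dots> \<le> 1 / 2 + 2 * K"
    using abs_sum_saw_rational_le[OF r cop, of "b - K / real r"] by simp
  finally have 1: "(\<Sum>s<r. saw (x s)) \<le> 1 / 2 + 2 * K" .
  have "- (1 / 2 + 2 * K) \<le> (\<Sum>s<r. saw ((b + K / real r) + of_int a * real s / real r)) - 2 * K"
    using abs_sum_saw_rational_le[OF r cop, of "b + K / real r"] by simp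
  also have "\<dots> = (\<Sum>s<r. saw (y s + K / real r) - 2 * (K / real r))"
    using r by (simp add: sum_subtractf y_def algebra_simps)
  also have "\<dots> \<le> (\<Sum>s<r. saw (x s))"
    by (intro sum_mono lo) auto
  finally show ?thesis
    using 1 by linarith
qed

text \<open>Blocks are cut off from the left until the next one would pass B; fewer than N terms are
  then left. T collects the starting points of the blocks, and its separation is what later allows T
  to be counted.\<close>

lemma greedy_block_bound:
  fixes r :: "nat \<Rightarrow> nat" and h :: "nat \<Rightarrow> real" and K :: real
  assumes r: "\<And>n. 0 < r n" "\<And>n. r n \<le> N"
    and h: "\<And>n. \<bar>h n\<bar> \<le> 1"
    and block: "\<And>n. A \<le> n \<Longrightarrow> n + r n \<le> B \<Longrightarrow> \<bar>\<Sum>k\<in>{n..<n + r n}. h k\<bar> \<le> K"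
  shows "\<exists>T \<subseteq> {A..<B}. (\<forall>n\<in>T. \<forall>n'\<in>T. n < n' \<longrightarrow> n + r n \<le> n') \<and>
      \<bar>\<Sum>k\<in>{A..<B}. h k\<bar> \<le> K * real (card T) + real N"
  using block
proof (induction "B - A" arbitrary: A rule: less_induct)
  case less
  show ?case
  proof (cases "A + r A \<le> B")
    case False
    have "\<bar>\<Sum>k\<in>{A..<B}. h k\<bar> \<le> (\<Sum>k\<in>{A..<B}. 1)"
      by (rule order_trans[OF sum_abs]) (intro sum_mono h)
    also have "\<dots> \<le> real N"
      using False r(2)[of A] by simp
    finally show ?thesis
      by (intro exI[of _ "{}"]) simp
  next
    case True
    define A' where "A' = A + r A"
    have A': "A < A'" "A' \<le> B"
      using True r(1)[of A] by (auto simp: A'_def)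
    have "B - A' < B - A"
      using A' by linarith
    from less.hyps[OF this] less.prems A'
    obtain T where T: "T \<subseteq> {A'..<B}" "\<forall>n\<in>T. \<forall>n'\<in>T. n < n' \<longrightarrow> n + r n \<le> n'"
      "\<bar>\<Sum>k\<in>{A'..<B}. h k\<bar> \<le> K * real (card T) + real N"
      by force
    have fin: "finite T"
      using T(1) finite_subset by blast
    have nin: "A \<notin> T"
      using T(1) A' by auto
    have "(\<Sum>k\<in>{A..<B}. h k) = (\<Sum>k\<in>{A..<A'}. h k) + (\<Sum>k\<in>{A'..<B}. h k)"
      using A' by (simp add: sum.atLeastLessThan_concat)
    moreover have "\<bar>\<Sum>k\<in>{A..<A'}. h k\<bar> \<le> K"
      using less.prems[of A] True unfolding A'_def by simp
    ultimately have "\<bar>\<Sum>k\<in>{A..<B}. h k\<bar> \<le> K * real (card (insert A T)) + real N"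
      using T(3) fin nin by (simp add: algebra_simps)
    moreover have "insert A T \<subseteq> {A..<B}"
      using T(1) A' by auto
    moreover have "\<forall>n\<in>insert A T. \<forall>n'\<in>insert A T. n < n' \<longrightarrow> n + r n \<le> n'"
      using T(1,2) A' unfolding A'_def by fastforce
    ultimately show ?thesis
      by blast
  qed
qed

text \<open>Windows of length r laid out from the minimum of U contain at most one point each, and
  every point lies within D of the minimum.\<close>

lemma card_separated_le:
  fixes U :: "nat set" and D :: real
  assumes fin: "finite U" and r: "r > 0"
    and sep: "\<And>n n'. n \<in> U \<Longrightarrow> n' \<in> U \<Longrightarrow> n < n' \<Longrightarrow> n + r \<le> n'"
    and diam: "\<And>n n'. n \<in> U \<Longrightarrow> n' \<in> U \<Longrightarrow> n < n' \<Longrightarrow> real n' - real n \<le> D"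
    and D: "D \<ge> 0"
  shows "real (card U) \<le> D / real r + 1"
proof (cases "U = {}")
  case True
  then show ?thesis
    using D by simp
next
  case False
  define m where "m = Min U"
  have m: "m \<in> U" "\<And>n. n \<in> U \<Longrightarrow> m \<le> n"
    using False fin by (auto simp: m_def)
  define \<phi> where "\<phi> n = (n - m) div r" for n
  have "\<phi> n < \<phi> n'" if "n \<in> U" "n' \<in> U" "n < n'" for n n'
  proof -
    have "\<phi> n + 1 = (n - m + r) div r"
      using r by (simp add: \<phi>_def)
    also have "\<dots> \<le> \<phi> n'"
      unfolding \<phi>_def using sep[OF that] m(2)[OF that(1)] by (intro div_le_mono) linarith
    finally show ?thesis
      by simp
  qed
  then have inj: "inj_on \<phi> U"
    by (metis (no_types, lifting) inj_onI linorder_neqE_nat less_irrefl)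
  have "\<phi> n \<le> nat \<lfloor>D / real r\<rfloor>" if "n \<in> U" for n
  proof -
    have "real (n - m) \<le> D"
      using diam[OF m(1) that] m(2)[OF that] D by (cases "m < n") auto
    then have "real (\<phi> n) \<le> D / real r"
      unfolding \<phi>_def using r
      by (meson divide_right_mono of_nat_0_le_iff of_nat_div_le_of_nat order_trans)
    then show ?thesis
      by (simp add: le_nat_floor)
  qed
  then have "card U \<le> card {..nat \<lfloor>D / real r\<rfloor>}"
    by (intro card_inj_on_le[OF inj]) auto
  then have "real (card U) \<le> real (nat \<lfloor>D / real r\<rfloor>) + 1"
    by simp
  also have "real (nat \<lfloor>D / real r\<rfloor>) \<le> D / real r"
    using D by simp
  finally show ?thesis
    by simp
qed

text \<open>Here g plays the role of the derivative of f. The bound \<open>1 / N \<le> g\<close> keeps the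
  numerators of all Dirichlet approximations to g positive, so that there are
  at most \<open>2 * r * G\<close> of them for each denominator r.\<close>

lemma abs_sum_saw_le:
  fixes f g :: "nat \<Rightarrow> real" and l L G :: real and A B N :: nat
  assumes N: "N > 0" and l: "l > 0" and L: "L \<ge> 0" "L * real N ^ 3 \<le> 1"
    and taylor: "\<And>n s. A \<le> n \<Longrightarrow> n + s < B \<Longrightarrow>
      \<bar>f (n + s) - f n - real s * g n\<bar> \<le> L * (real s)\<^sup>2"
    and grow: "\<And>n s. A \<le> n \<Longrightarrow> n + s < B \<Longrightarrow> l * real s \<le> g (n + s) - g n"
    and lower: "\<And>n. A \<le> n \<Longrightarrow> n < B \<Longrightarrow> 1 / real N \<le> g n"
    and upper: "\<And>n. A \<le> n \<Longrightarrow> n < B \<Longrightarrow> g n \<le> G"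
    and G: "1 / real N \<le> G"
  shows "\<bar>\<Sum>n\<in>{A..<B}. saw (f n)\<bar> \<le>
    5 * (4 * G / (real N * l) * harm N + 2 * G * (real N)\<^sup>2) + real N"
proof -
  have "\<exists>a r. 0 < r \<and> r \<le> N \<and> coprime a (int r) \<and> \<bar>real r * g n - of_int a\<bar> < 1 / real N" for n
  proof -
    obtain h k where hk: "coprime h k" "0 < k" "k \<le> int N"
        "\<bar>of_int k * g n - of_int h\<bar> < 1 / real N"
      using Dirichlet_approx_coprime[OF N] by metis
    then show ?thesis
      by (intro exI[of _ h] exI[of _ "nat k"]) auto
  qed
  then obtain a :: "nat \<Rightarrow> int" and r :: "nat \<Rightarrow> nat" where
    r: "\<And>n. 0 < r n" "\<And>n. r n \<le> N" and cop: "\<And>n. coprime (a n) (int (r n))"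
    and appr: "\<And>n. \<bar>real (r n) * g n - of_int (a n)\<bar> < 1 / real N"
    by metis
  have G0: "G > 0"
    using G N by (meson divide_pos_pos less_le_trans of_nat_0_less_iff zero_less_one)
  \<comment> \<open>Over at most r steps the Dirichlet error contributes at most
    \<open>1 / N\<close> and the Taylor error at most \<open>L * N^2\<close>, and both are at most
    \<open>1 / r\<close>. So the perturbed sum is estimated with \<open>K = 2\<close>, which gives
    \<open>9 / 2\<close>, rounded up to 5.\<close>
  have block: "\<bar>\<Sum>k\<in>{n..<n + r n}. saw (f k)\<bar> \<le> 5" if n: "A \<le> n" "n + r n \<le> B" for n
  proof -
    have near: "\<bar>f (n + s) - (f n + of_int (a n) * real s / real (r n))\<bar> \<le> 2 / real (r n)"
      if s: "s < r n" for s
    proof -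
      have rn: "real (r n) > 0"
        using r(1)[of n] by simp
      have "\<bar>g n - of_int (a n) / real (r n)\<bar> = \<bar>real (r n) * g n - of_int (a n)\<bar> / real (r n)"
        using rn by (simp add: field_simps abs_if)
      also have "\<dots> \<le> 1 / real N / real (r n)"
        using appr[of n] rn by (intro divide_right_mono) auto
      finally have g: "\<bar>g n - of_int (a n) / real (r n)\<bar> \<le> 1 / real N / real (r n)" .
      have "\<bar>real s * (g n - of_int (a n) / real (r n))\<bar> \<le> real (r n) * (1 / real N / real (r n))"
        unfolding abs_mult using g s by (intro mult_mono) auto
      also have "\<dots> = 1 / real N"
        using rn by simp
      also have "\<dots> \<le> 1 / real (r n)"
        using r[of n] by (simp add: field_simps)
      finally have 1: "\<bar>real s * (g n - of_int (a n) / real (r n))\<bar> \<le> 1 / real (r n)" .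
      have "L * (real s)\<^sup>2 \<le> L * (real N)\<^sup>2"
        using s r(2)[of n] L(1) by (intro mult_left_mono power_mono) auto
      also have "\<dots> \<le> 1 / real N"
        using L(2) N by (simp add: field_simps power3_eq_cube power2_eq_square)
      also have "\<dots> \<le> 1 / real (r n)"
        using r[of n] by (simp add: field_simps)
      finally have 2: "L * (real s)\<^sup>2 \<le> 1 / real (r n)" .
      have "f (n + s) - (f n + of_int (a n) * real s / real (r n))
          = (f (n + s) - f n - real s * g n) + real s * (g n - of_int (a n) / real (r n))"
        by (simp add: algebra_simps)
      also have "\<bar>\<dots>\<bar> \<le> 1 / real (r n) + 1 / real (r n)"
        using order_trans[OF taylor[of n s] 2] 1 n s
        by (intro order_trans[OF abs_triangle_ineq] add_mono) auto
      finally show ?thesis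
        by simp
    qed
    have "(\<Sum>k\<in>{n..<n + r n}. saw (f k)) = (\<Sum>s<r n. saw (f (n + s)))"
      using sum.shift_bounds_nat_ivl[of "\<lambda>k. saw (f k)" 0 n "r n"]
      by (simp add: add.commute lessThan_atLeast0)
    then show ?thesis
      using abs_sum_saw_near_rational_le[OF r(1)[of n] cop near] by simp
  qed
  have saw1: "\<bar>saw (f n)\<bar> \<le> 1" for n
    using abs_saw_le[of "f n"] by linarith
  obtain T where T: "T \<subseteq> {A..<B}" "\<And>n n'. n \<in> T \<Longrightarrow> n' \<in> T \<Longrightarrow> n < n' \<Longrightarrow> n + r n \<le> n'"
      "\<bar>\<Sum>k\<in>{A..<B}. saw (f k)\<bar> \<le> 5 * real (card T) + real N"
    using greedy_block_bound[where h = "\<lambda>k. saw (f k)" and r = r and N = N and A = A and B = B and K = 5,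
        OF r saw1 block] by blast
  have finT: "finite T"
    using T(1) finite_subset by blast
  \<comment> \<open>T is split by Dirichlet fraction: it remains to count the fractions
    \<open>b / p\<close> and to bound each class.\<close>
  define U where "U p b = {n \<in> T. r n = p \<and> a n = b}" for p b
  \<comment> \<open>The factor 2 absorbs the approximation error, since
    \<open>1 / N \<le> G \<le> r * G\<close>.\<close>
  have a_range: "a n \<in> {1..\<lfloor>2 * real (r n) * G\<rfloor>}" if "n \<in> T" for n
  proof -
    have n: "A \<le> n" "n < B"
      using T(1) that by auto
    have r1: "real (r n) \<ge> 1"
      using r(1)[of n] by simp
    have "0 \<le> g n"
      using lower[OF n] by (meson divide_nonneg_nonneg of_nat_0_le_iff order_trans zero_le_one)
    then have "1 / real N \<le> real (r n) * g n"
      using lower[OF n] r1 mult_right_mono[of 1 "real (r n)" "g n"] by simp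
    then have "a n > 0"
      using appr[of n] by linarith
    moreover have "real (r n) * g n \<le> real (r n) * G" "G \<le> real (r n) * G"
      using upper[OF n] r1 G0 by auto
    then have "of_int (a n) \<le> 2 * real (r n) * G"
      using appr[of n] G by linarith
    then have "a n \<le> \<lfloor>2 * real (r n) * G\<rfloor>"
      by (simp add: le_floor_iff)
    ultimately show ?thesis
      by simp
  qed
  \<comment> \<open>Within a class all values of g are within \<open>1 / (p * N)\<close> of
    \<open>b / p\<close>. Growth at rate l turns this into a bound on the distance of the starts,
    which are at least p apart.\<close>
  have cardU: "real (card (U p b)) \<le> 2 / (real p * real N * l) / real p + 1" if p: "p > 0" for p b
  proof (rule card_separated_le)
    show "finite (U p b)"
      using finT by (simp add: U_def)
    show "p > 0"
      by fact
    show "n + p \<le> n'" if "n \<in> U p b" "n' \<in> U p b" "n < n'" for n n'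
      using that T(2)[of n n'] by (auto simp: U_def)
    show "real n' - real n \<le> 2 / (real p * real N * l)"
      if "n \<in> U p b" "n' \<in> U p b" "n < n'" for n n'
    proof -
      have n: "A \<le> n" "n + (n' - n) < B" "r n = p" "r n' = p" "a n = b" "a n' = b"
        using that T(1) by (auto simp: U_def)
      have "l * (real n' - real n) \<le> g n' - g n"
        using grow[OF n(1,2)] that(3) by (simp add: of_nat_diff)
      then have "real p * (l * (real n' - real n)) \<le> real p * (g n' - g n)"
        using p by (intro mult_left_mono) auto
      also have "\<dots> \<le> 1 / real N + 1 / real N"
        using appr[of n] appr[of n'] n by (simp add: algebra_simps)
      finally show ?thesis
        using p N l by (simp add: field_simps)
    qed
    show "2 / (real p * real N * l) \<ge> 0"
      using l by simp
  qed
  have "T \<subseteq> (\<Union>p\<in>{1..N}. \<Union>b\<in>{1..\<lfloor>2 * real p * G\<rfloor>}. U p b)"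
    using a_range r by (fastforce simp: U_def Suc_le_eq)
  then have "card T \<le> card (\<Union>p\<in>{1..N}. \<Union>b\<in>{1..\<lfloor>2 * real p * G\<rfloor>}. U p b)"
    using finT by (intro card_mono) (auto simp: U_def)
  also have "\<dots> \<le> (\<Sum>p\<in>{1..N}. card (\<Union>b\<in>{1..\<lfloor>2 * real p * G\<rfloor>}. U p b))"
    by (intro card_UN_le) auto
  also have "\<dots> \<le> (\<Sum>p\<in>{1..N}. \<Sum>b\<in>{1..\<lfloor>2 * real p * G\<rfloor>}. card (U p b))"
    by (intro sum_mono card_UN_le) auto
  finally have "real (card T) \<le> (\<Sum>p\<in>{1..N}. \<Sum>b\<in>{1..\<lfloor>2 * real p * G\<rfloor>}. real (card (U p b)))"
    by (metis (mono_tags, lifting) of_nat_le_iff of_nat_sum sum.cong)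
  also have "\<dots> \<le> (\<Sum>p\<in>{1..N}. \<Sum>b\<in>{1..\<lfloor>2 * real p * G\<rfloor>}. 2 / (real p * real N * l) / real p + 1)"
    using cardU by (intro sum_mono) auto
  \<comment> \<open>For each p there are at most \<open>2 * p * G\<close> numerators b; the part
    proportional to \<open>1 / p\<close> then sums to a harmonic number.\<close>
  also have "\<dots> \<le> (\<Sum>p\<in>{1..N}. 4 * G / (real N * l) * inverse (real p) + 2 * G * real N)"
  proof (intro sum_mono)
    fix p assume p: "p \<in> {1..N}"
    have "real (card {1..\<lfloor>2 * real p * G\<rfloor>}) \<le> 2 * real p * G"
      using G0 by simp
    then have "(\<Sum>b\<in>{1..\<lfloor>2 * real p * G\<rfloor>}. 2 / (real p * real N * l) / real p + 1)
        \<le> (2 * real p * G) * (2 / (real p * real N * l) / real p + 1)"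
      unfolding sum_constant using l by (intro mult_right_mono) auto
    also have "\<dots> = 4 * G / (real N * l) * inverse (real p) + 2 * G * real p"
      using p l N by (simp add: field_simps)
    also have "\<dots> \<le> 4 * G / (real N * l) * inverse (real p) + 2 * G * real N"
      using p G0 by simp
    finally show "(\<Sum>b\<in>{1..\<lfloor>2 * real p * G\<rfloor>}. 2 / (real p * real N * l) / real p + 1)
        \<le> 4 * G / (real N * l) * inverse (real p) + 2 * G * real N" .
  qed
  also have "\<dots> = 4 * G / (real N * l) * harm N + 2 * G * (real N)\<^sup>2"
    by (simp add: sum.distrib sum_distrib_left harm_def power2_eq_square)
  finally have "5 * real (card T) + real N
      \<le> 5 * (4 * G / (real N * l) * harm N + 2 * G * (real N)\<^sup>2) + real N"
    by simp
  with T(3) show ?thesis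
    by (rule order_trans)
qed

section \<open>The values of \<open>n\<^sup>c\<close> in residue classes\<close>

lemma powr_mean_value:
  fixes x y p :: real
  assumes "0 < x" "x \<le> y"
  obtains z where "x \<le> z" "z \<le> y" "y powr p - x powr p = (y - x) * (p * z powr (p - 1))"
proof (cases "x = y")
  case True
  then show ?thesis
    using that[of x] by simp
next
  case False
  have "\<exists>z. x < z \<and> z < y \<and> y powr p - x powr p = (y - x) * (p * z powr (p - 1))"
    using False assms by (intro MVT2) (auto intro!: derivative_eq_intros simp: field_simps powr_diff)
  then show ?thesis
    using that by (meson less_imp_le)
qed

text \<open>For \<open>0 \<le> p \<le> 1\<close> the derivative of the power is nonincreasing, so
  its value at the right end bounds the slope from below; in \<open>powr_diff_le\<close> the left
  end bounds it from above.\<close>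

lemma powr_diff_ge:
  fixes x y p :: real
  assumes "0 < x" "x \<le> y" "0 \<le> p" "p \<le> 1"
  shows "p * y powr (p - 1) * (y - x) \<le> y powr p - x powr p"
proof -
  obtain z where z: "x \<le> z" "z \<le> y" "y powr p - x powr p = (y - x) * (p * z powr (p - 1))"
    using powr_mean_value[OF assms(1,2)] by metis
  have "y powr (p - 1) \<le> z powr (p - 1)"
    using z assms by (intro powr_mono2') auto
  then have "(y - x) * (p * y powr (p - 1)) \<le> (y - x) * (p * z powr (p - 1))"
    using assms by (intro mult_left_mono) auto
  with z(3) show ?thesis
    by (simp add: mult_ac)
qed

lemma powr_diff_le:
  fixes x y p :: real
  assumes "0 < x" "x \<le> y" "0 \<le> p" "p \<le> 1"
  shows "y powr p - x powr p \<le> p * x powr (p - 1) * (y - x)"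
proof -
  obtain z where z: "x \<le> z" "z \<le> y" "y powr p - x powr p = (y - x) * (p * z powr (p - 1))"
    using powr_mean_value[OF assms(1,2)] by metis
  have "z powr (p - 1) \<le> x powr (p - 1)"
    using z assms by (intro powr_mono2') auto
  then have "(y - x) * (p * z powr (p - 1)) \<le> (y - x) * (p * x powr (p - 1))"
    using assms by (intro mult_left_mono) auto
  with z(3) show ?thesis
    by (simp add: mult_ac)
qed

text \<open>The mean value theorem is used twice, for the exponent c and then for
  \<open>c - 1\<close>. The constant is twice that of Taylor's formula, which is harmless
  here.\<close>

lemma powr_linear_approx:
  fixes x y c :: real
  assumes "0 < x" "x \<le> y" "1 \<le> c" "c \<le> 2"
  shows "\<bar>y powr c - x powr c - (y - x) * (c * x powr (c - 1))\<bar>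
    \<le> c * (c - 1) * x powr (c - 2) * (y - x)\<^sup>2"
proof -
  obtain z where z: "x \<le> z" "z \<le> y" "y powr c - x powr c = (y - x) * (c * z powr (c - 1))"
    using powr_mean_value[OF assms(1,2)] by metis
  have "z powr (c - 1) - x powr (c - 1) \<le> (c - 1) * x powr (c - 2) * (z - x)"
    using powr_diff_le[of x z "c - 1"] z assms by simp
  also have "\<dots> \<le> (c - 1) * x powr (c - 2) * (y - x)"
    using z assms by (intro mult_left_mono) auto
  finally have 1: "z powr (c - 1) - x powr (c - 1) \<le> (c - 1) * x powr (c - 2) * (y - x)" .
  have 2: "0 \<le> z powr (c - 1) - x powr (c - 1)"
    using z assms by (simp add: powr_mono2)
  have eq: "y powr c - x powr c - (y - x) * (c * x powr (c - 1))
      = c * (y - x) * (z powr (c - 1) - x powr (c - 1))"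
    unfolding z(3) by (simp add: algebra_simps)
  have "c * (y - x) * (z powr (c - 1) - x powr (c - 1))
      \<le> c * (y - x) * ((c - 1) * x powr (c - 2) * (y - x))"
    using 1 assms by (intro mult_left_mono) auto
  moreover have "0 \<le> c * (y - x) * (z powr (c - 1) - x powr (c - 1))"
    using 2 assms by auto
  ultimately show ?thesis
    unfolding eq by (simp add: power2_eq_square mult_ac)
qed

lemma harm_le_ln: "N > 0 \<Longrightarrow> harm N \<le> 1 + ln (real N)"
  using euler_mascheroni_sequence_decreasing[of 1 N] by (simp add: harm_def)

section \<open>Sawtooth sums over the dyadic range\<close>

definition dyadic :: "real \<Rightarrow> nat set" where
  "dyadic X = {n. n > 0 \<and> X / 2 < real n \<and> real n \<le> X}"

lemma dyadic_eq_atLeastLessThan: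
  assumes "X \<ge> 0"
  shows "dyadic X = {nat \<lfloor>X / 2\<rfloor> + 1..<nat \<lfloor>X\<rfloor> + 1}"
proof -
  have "X / 2 < real n \<longleftrightarrow> nat \<lfloor>X / 2\<rfloor> + 1 \<le> n" for n
    using assms by (simp add: Suc_le_eq nat_less_iff floor_less_iff)
  moreover have "real n \<le> X \<longleftrightarrow> n < nat \<lfloor>X\<rfloor> + 1" for n
    using assms by (auto simp: le_nat_floor less_Suc_eq_le) linarith
  ultimately show ?thesis
    unfolding dyadic_def by auto
qed

lemma finite_dyadic: "X \<ge> 0 \<Longrightarrow> finite (dyadic X)"
  by (simp add: dyadic_eq_atLeastLessThan)

lemma card_dyadic: "X \<ge> 0 \<Longrightarrow> \<bar>real (card (dyadic X)) - X / 2\<bar> \<le> 1"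
proof -
  assume X: "X \<ge> 0"
  have "nat \<lfloor>X / 2\<rfloor> \<le> nat \<lfloor>X\<rfloor>"
    using X by (intro nat_mono floor_mono) simp
  then have "real (card (dyadic X)) = of_int \<lfloor>X\<rfloor> - of_int \<lfloor>X / 2\<rfloor>"
    using X by (simp add: dyadic_eq_atLeastLessThan of_nat_diff)
  then show ?thesis
    by linarith
qed

text \<open>This is the general sawtooth estimate with N between \<open>2 * w\<close> and
  \<open>3 * w\<close>, where \<open>w = X powr (3 / 4 - c / 2)\<close>, and with
  \<open>L = 2 * l\<close>. In the dominant term q cancels, so the bound is uniform in b and in all
  admissible q.\<close>

lemma abs_sum_saw_powr_le:
  fixes c X b :: real and q :: nat
  assumes c: "1 < c" "c < 7 / 6" and X: "X \<ge> 54 ^ 4"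
    and q: "q > 0" "real q \<le> X powr (c / 2 - 1 / 4)"
  shows "\<bar>\<Sum>n\<in>dyadic X. saw (real n powr c / real q - b)\<bar>
    \<le> (10 / (c - 1) + 140) * (X powr (c / 2 + 1 / 4) * (1 + ln X))"
proof -
  define w where "w = X powr (3 / 4 - c / 2)"
  define N where "N = nat \<lceil>2 * w\<rceil>"
  define A where "A = nat \<lfloor>X / 2\<rfloor> + 1"
  define B where "B = nat \<lfloor>X\<rfloor> + 1"
  define f where "f n = real n powr c / real q - b" for n
  define g where "g n = c * real n powr (c - 1) / real q" for n
  define l where "l = c * (c - 1) * X powr (c - 2) / real q"
  define G where "G = c * X powr (c - 1) / real q"
  define E where "E = X powr (c / 2 + 1 / 4)"
  have X1: "X \<ge> 1"
    using X by simp
  have w1: "w \<ge> 1"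
    unfolding w_def using X1 c by (intro ge_one_powr_ge_zero) auto
  have N: "2 * w \<le> real N" "real N \<le> 3 * w"
    using w1 unfolding N_def by linarith+
  have N0: "N > 0"
    using N(1) w1 by (cases N) auto
  have dy: "dyadic X = {A..<B}"
    unfolding A_def B_def using X1 by (intro dyadic_eq_atLeastLessThan) auto
  have AB: "X / 2 \<le> real n" "0 < real n" "real n \<le> X" if "A \<le> n" "n < B" for n
  proof -
    have "n \<in> dyadic X"
      using that unfolding dy by simp
    then show "X / 2 \<le> real n" "0 < real n" "real n \<le> X"
      by (auto simp: dyadic_def)
  qed
  have l: "l > 0"
    unfolding l_def using c q X1 by auto
  have q1: "1 \<le> real q"
    using q by simp
  have c2: "c * (c - 1) \<le> 1"
    using mult_mono[of c "7 / 6" "c - 1" "1 / 6"] c by simp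
  have "l * real N ^ 3 \<le> X powr (c - 2) * (3 * w) ^ 3"
  proof (intro mult_mono power_mono N)
    have "l \<le> c * (c - 1) * X powr (c - 2) / 1"
      unfolding l_def using q1 c by (intro divide_left_mono) auto
    also have "\<dots> \<le> 1 * X powr (c - 2) / 1"
      using c2 by (intro divide_right_mono mult_right_mono) auto
    finally show "l \<le> X powr (c - 2)"
      by simp
  qed auto
  also have "\<dots> = 27 * X powr (1 / 4 - c / 2)"
    unfolding w_def using X1 by (simp add: power3_eq_cube flip: powr_add)
  also have "\<dots> \<le> 27 * X powr (- (1 / 4))"
    using X1 c by (intro mult_left_mono powr_mono) auto
  \<comment> \<open>The threshold for X comes from here: \<open>54 = 2 * 27\<close>, with 27 from
    \<open>N \<le> 3 * w\<close> and 2 from \<open>L = 2 * l\<close>.\<close>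
  also have "X powr (- (1 / 4)) \<le> (54 ^ 4) powr (- (1 / 4))"
    using X by (intro powr_mono2') auto
  also have "(54 ^ 4 :: real) powr (- (1 / 4)) = 1 / 54"
  proof -
    have "(54 ^ 4 :: real) = 54 powr 4"
      by (simp flip: powr_realpow)
    then show ?thesis
      by (simp add: powr_powr powr_minus_divide del: power_numeral_even)
  qed
  finally have L: "2 * l * real N ^ 3 \<le> 1"
    by simp
  \<comment> \<open>Since \<open>2 - c \<le> 1\<close>, the second derivative at
    \<open>X / 2\<close> is at most twice that at X. This is why the Taylor constant is
    \<open>2 * l\<close>.\<close>
  have X_half: "(X / 2) powr (c - 2) \<le> 2 * X powr (c - 2)"
  proof -
    have "(X / 2) powr (c - 2) = 2 powr (2 - c) * X powr (c - 2)"
      using X1 by (simp add: powr_divide powr_diff field_simps)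
    also have "\<dots> \<le> 2 powr 1 * X powr (c - 2)"
      using c by (intro mult_right_mono powr_mono) auto
    finally show ?thesis
      by simp
  qed
  \<comment> \<open>The size condition on q enters here: it gives
    \<open>X powr (c - 1) / q \<ge> 1 / w\<close>, which keeps the derivative above
    \<open>1 / N\<close>.\<close>
  have lower: "1 / real N \<le> g n" if n: "A \<le> n" "n < B" for n
  proof -
    have wX: "w * X powr (c - 1) = X powr (c / 2 - 1 / 4)"
      unfolding w_def by (simp flip: powr_add)
    have "1 / real N \<le> 1 / (2 * w)"
      using N w1 by (intro divide_left_mono) auto
    also have "\<dots> = 1 / 2 * X powr (c - 1) / X powr (c / 2 - 1 / 4)"
      unfolding wX[symmetric] using X1 w1 by simp
    also have "\<dots> \<le> 1 / 2 * X powr (c - 1) / real q"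
      using q X1 by (intro divide_left_mono) auto
    also have "\<dots> \<le> g n"
    proof -
      have "1 / 2 * X powr (c - 1) \<le> c * (2 powr (- (c - 1))) * X powr (c - 1)"
      proof (intro mult_right_mono)
        have "1 / 2 = 1 * (2::real) powr (- 1)"
          by (simp add: powr_minus_divide)
        also have "\<dots> \<le> c * (2 powr (- (c - 1)))"
          using c by (intro mult_mono powr_mono) auto
        finally show "1 / 2 \<le> c * (2 powr (- (c - 1)))" .
      qed auto
      also have "\<dots> = c * (X / 2) powr (c - 1)"
        using X1 by (simp add: powr_divide powr_minus_divide del: minus_diff_eq)
      also have "\<dots> \<le> c * real n powr (c - 1)"
        using AB[OF n] c X1 by (intro mult_left_mono powr_mono2) auto
      finally show ?thesis
        unfolding g_def by (intro divide_right_mono) auto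
    qed
    finally show ?thesis .
  qed
  have upper: "g n \<le> G" if n: "A \<le> n" "n < B" for n
    unfolding g_def G_def using AB[OF n] c
    by (intro divide_right_mono mult_left_mono powr_mono2) auto
  have NX: "real N \<le> X"
  proof -
    have "w \<le> X powr (1 / 4)"
      unfolding w_def using X1 c by (intro powr_mono) auto
    moreover have "X powr (1 / 4) * 3 \<le> X powr (1 / 4) * X powr (3 / 4)"
    proof (intro mult_left_mono)
      have "(3::real) = (3 powr (4 / 3)) powr (3 / 4)"
        by (simp add: powr_powr)
      also have "\<dots> \<le> X powr (3 / 4)"
      proof (intro powr_mono2)
        have "(3::real) powr (4 / 3) \<le> 3 powr 2"
          by (intro powr_mono) auto
        also have "(3::real) powr 2 \<le> X"
          using X by simp
        finally show "(3::real) powr (4 / 3) \<le> X" .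
      qed auto
      finally show "3 \<le> X powr (3 / 4)" .
    qed auto
    moreover have "X powr (1 / 4) * X powr (3 / 4) = X"
      using X1 by (simp flip: powr_add)
    ultimately show ?thesis
      using N(2) by linarith
  qed
  have "X \<ge> 2"
    using X by simp
  then have "\<lfloor>X / 2\<rfloor> + 1 \<le> \<lfloor>X\<rfloor>"
    by linarith
  \<comment> \<open>The interval is non-empty, so the bounds for g at the single point A link
    \<open>1 / N\<close> to G.\<close>
  then have nB: "A \<le> A" "A < B"
    unfolding A_def B_def using X1 by linarith+
  have G: "1 / real N \<le> G"
    using lower[OF nB] upper[OF nB] by linarith
  have main: "\<bar>\<Sum>n\<in>{A..<B}. saw (f n)\<bar>
      \<le> 5 * (4 * G / (real N * l) * harm N + 2 * G * (real N)\<^sup>2) + real N"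
  proof (rule abs_sum_saw_le[OF N0 l _ L _ _ lower upper G])
    show "0 \<le> 2 * l"
      using l by simp
    show "\<bar>f (n + s) - f n - real s * g n\<bar> \<le> 2 * l * (real s)\<^sup>2" if n: "A \<le> n" "n + s < B" for n s
    proof -
      have n': "X / 2 \<le> real n" "0 < real n"
        using AB[of n] n by auto
      have "f (n + s) - f n - real s * g n
          = (real (n + s) powr c - real n powr c - (real (n + s) - real n) * (c * real n powr (c - 1))) / real q"
        unfolding f_def g_def using q1 by (simp add: field_simps)
      also have "\<bar>\<dots>\<bar> \<le> c * (c - 1) * real n powr (c - 2) * (real (n + s) - real n)\<^sup>2 / real q"
        unfolding abs_divide using powr_linear_approx[of "real n" "real (n + s)" c] n' c q1
        by (simp add: divide_right_mono)
      also have "\<dots> \<le> c * (c - 1) * (2 * X powr (c - 2)) * (real (n + s) - real n)\<^sup>2 / real q"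
      proof (intro divide_right_mono mult_right_mono mult_left_mono)
        have "real n powr (c - 2) \<le> (X / 2) powr (c - 2)"
          using n' X1 c by (intro powr_mono2') auto
        with X_half show "real n powr (c - 2) \<le> 2 * X powr (c - 2)"
          by linarith
      qed (use c in auto)
      also have "\<dots> = 2 * l * (real s)\<^sup>2"
        unfolding l_def by simp
      finally show ?thesis .
    qed
    show "l * real s \<le> g (n + s) - g n" if n: "A \<le> n" "n + s < B" for n s
    proof -
      have n': "0 < real n" "0 < real (n + s)" "real (n + s) \<le> X"
        using AB[of n] AB[of "n + s"] n by auto
      have "X powr (c - 2) \<le> real (n + s) powr (c - 2)"
        using n' c by (intro powr_mono2') auto
      then have "(c - 1) * X powr (c - 2) * real s \<le> (c - 1) * real (n + s) powr (c - 2) * real s"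
        using c by (intro mult_left_mono mult_right_mono) auto
      also have "\<dots> \<le> real (n + s) powr (c - 1) - real n powr (c - 1)"
        using powr_diff_ge[of "real n" "real (n + s)" "c - 1"] n' c by simp
      finally have "c * ((c - 1) * X powr (c - 2) * real s) / real q
          \<le> c * (real (n + s) powr (c - 1) - real n powr (c - 1)) / real q"
        using c by (intro divide_right_mono mult_left_mono) auto
      then show ?thesis
        unfolding l_def g_def by (simp add: algebra_simps diff_divide_distrib)
    qed
  qed
  have lnX: "ln X \<ge> 0"
    using X1 by simp
  \<comment> \<open>Both G and l carry the factor \<open>c / q\<close>, which cancels.\<close>
  have "4 * G / (real N * l) = 4 * X / ((c - 1) * real N)"
  proof -
    have "X powr (c - 1) = X * X powr (c - 2)"
      using X1 powr_add[of X 1 "c - 2"] by simp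
    then show ?thesis
      unfolding G_def l_def using c q1 X1 N0 by (simp add: field_simps)
  qed
  also have "\<dots> \<le> 4 * X / ((c - 1) * (2 * w))"
    using N w1 c X1 by (intro divide_left_mono mult_left_mono mult_pos_pos) auto
  also have "\<dots> = 2 / (c - 1) * (X / w)"
    by simp
  also have "X / w = E"
    unfolding w_def E_def using X1 powr_diff[of X 1 "3 / 4 - c / 2"] by (simp add: add.commute)
  finally have 1: "4 * G / (real N * l) \<le> 2 / (c - 1) * E" .
  have "ln (real N) \<le> ln X"
    using NX N0 by simp
  then have "harm N \<le> 1 + ln X"
    using harm_le_ln[OF N0] by linarith
  then have 2: "4 * G / (real N * l) * harm N \<le> 2 / (c - 1) * E * (1 + ln X)"
    using 1 c by (intro mult_mono) (auto simp: harm_nonneg E_def)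
  have E1: "X powr p \<le> E" if "p \<le> c / 2 + 1 / 4" for p
    unfolding E_def using that X1 by (intro powr_mono) auto
  have "2 * G * (real N)\<^sup>2 \<le> 2 * (7 / 6 * X powr (c - 1)) * (3 * w)\<^sup>2"
  proof (intro mult_mono power_mono N order_refl)
    have "G \<le> c * X powr (c - 1) / 1"
      unfolding G_def using q1 c by (intro divide_left_mono) auto
    also have "\<dots> \<le> 7 / 6 * X powr (c - 1) / 1"
      using c by (intro divide_right_mono mult_right_mono) auto
    finally show "G \<le> 7 / 6 * X powr (c - 1)"
      by simp
  qed (use c in \<open>auto simp: G_def\<close>)
  also have "\<dots> = 21 * (X powr (c - 1) * (w * w))"
    by (simp add: power2_eq_square)
  also have "X powr (c - 1) * (w * w) = X powr (1 / 2)"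
    unfolding w_def using X1 by (simp flip: powr_add)
  also have "\<dots> \<le> E"
    using c by (intro E1) auto
  finally have 3: "2 * G * (real N)\<^sup>2 \<le> 21 * E"
    by simp
  have "w \<le> E"
    unfolding w_def using c by (intro E1) auto
  then have "real N \<le> 3 * E"
    using N by linarith
  then have "5 * (4 * G / (real N * l) * harm N + 2 * G * (real N)\<^sup>2) + real N
      \<le> 5 * (2 / (c - 1) * E * (1 + ln X) + 21 * E) + 3 * E"
    using 2 3 by (intro add_mono mult_left_mono) auto
  also have "\<dots> = 10 / (c - 1) * (E * (1 + ln X)) + 108 * E"
    by (simp add: field_simps)
  also have "\<dots> \<le> 10 / (c - 1) * (E * (1 + ln X)) + 140 * (E * (1 + ln X))"
  proof -
    have "E * 1 \<le> E * (1 + ln X)"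
      using lnX by (intro mult_left_mono) (auto simp: E_def)
    moreover have "0 \<le> E"
      by (simp add: E_def)
    ultimately show ?thesis
      by (intro add_left_mono) linarith
  qed
  also have "\<dots> = (10 / (c - 1) + 140) * (E * (1 + ln X))"
    by (simp add: algebra_simps)
  finally show ?thesis
    using main unfolding dy f_def E_def by (rule order_trans[rotated])
qed

section \<open>From sawtooth sums to residue classes\<close>

lemma div_diff_one:
  fixes u q :: int
  assumes "q > 0"
  shows "u div q - (u - 1) div q = (if q dvd u then 1 else 0)"
proof (cases "q dvd u")
  case True
  then obtain k where k: "u = q * k"
    by (elim dvdE)
  have "(u - 1) div q = k - 1"
    by (rule int_div_pos_eq[where r = "q - 1"]) (use assms k in \<open>auto simp: algebra_simps\<close>)
  with True k assms show ?thesis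
    by simp
next
  case False
  then have "u mod q \<noteq> 0"
    by (simp add: dvd_eq_mod_eq_0)
  then have "u mod q > 0"
    using pos_mod_sign[OF assms, of u] by linarith
  then have "(u - 1) div q = u div q"
    using pos_mod_bound[OF assms, of u] mult_div_mod_eq[of q u]
    by (intro int_div_pos_eq[where r = "u mod q - 1"]) linarith+
  with False show ?thesis
    by simp
qed

text \<open>The floors of \<open>(t - b) / q\<close> and \<open>(t - b - 1) / q\<close> differ by 1
  if \<open>\<lfloor>t\<rfloor>\<close> is congruent to b and agree otherwise. Writing each floor as
  its argument minus \<open>saw\<close> and \<open>1 / 2\<close> leaves \<open>1 / q\<close> and two
  sawtooth terms.\<close>

lemma of_bool_cong_floor_eq:
  fixes t :: real and b q :: nat
  assumes "q > 0" "t \<ge> 0"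
  shows "of_bool ([nat \<lfloor>t\<rfloor> = b] (mod q))
    = 1 / real q + saw (t / real q - (real b + 1) / real q) - saw (t / real q - real b / real q)"
proof -
  have fl: "\<lfloor>t / real q - real_of_int v / real q\<rfloor> = (\<lfloor>t\<rfloor> - v) div int q" for v
    using floor_divide_real_eq_div[of "int q" "t - of_int v"] by (simp add: diff_divide_distrib)
  have "[nat \<lfloor>t\<rfloor> = b] (mod q) \<longleftrightarrow> [\<lfloor>t\<rfloor> = int b] (mod int q)"
    using assms(2) cong_int_iff[of "nat \<lfloor>t\<rfloor>" b q] by simp
  also have "\<dots> \<longleftrightarrow> int q dvd \<lfloor>t\<rfloor> - int b"
    by (simp add: cong_iff_dvd_diff)
  finally have "of_bool ([nat \<lfloor>t\<rfloor> = b] (mod q))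
      = real_of_int ((\<lfloor>t\<rfloor> - int b) div int q - (\<lfloor>t\<rfloor> - int b - 1) div int q)"
    using assms(1) by (simp add: div_diff_one)
  also have "\<dots> = of_int \<lfloor>t / real q - real b / real q\<rfloor> - of_int \<lfloor>t / real q - (real b + 1) / real q\<rfloor>"
    using fl[of "int b"] fl[of "int b + 1"] by (simp add: algebra_simps)
  finally show ?thesis
    by (simp add: saw_def frac_def add_divide_distrib)
qed

text \<open>The factor 2 accounts for the two sawtooth sums, with shifts \<open>(b + 1) / q\<close>
  and \<open>b / q\<close>.\<close>

lemma card_floor_powr_cong:
  fixes c X :: real and b q :: nat
  assumes c: "1 < c" "c < 7 / 6" and X: "X \<ge> 54 ^ 4"
    and q: "q > 0" "real q \<le> X powr (c / 2 - 1 / 4)"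
  shows "\<bar>real (card {n \<in> dyadic X. [nat \<lfloor>real n powr c\<rfloor> = b] (mod q)}) - real (card (dyadic X)) / real q\<bar>
    \<le> 2 * (10 / (c - 1) + 140) * (X powr (c / 2 + 1 / 4) * (1 + ln X))"
proof -
  have fin: "finite (dyadic X)"
    using X by (intro finite_dyadic) simp
  have "real (card {n \<in> dyadic X. [nat \<lfloor>real n powr c\<rfloor> = b] (mod q)})
      = (\<Sum>n\<in>dyadic X. of_bool ([nat \<lfloor>real n powr c\<rfloor> = b] (mod q)))"
    using fin by (simp add: sum.If_cases Int_def of_bool_def)
  also have "\<dots> = real (card (dyadic X)) / real q
      + (\<Sum>n\<in>dyadic X. saw (real n powr c / real q - (real b + 1) / real q))
      - (\<Sum>n\<in>dyadic X. saw (real n powr c / real q - real b / real q))"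
    using q(1) by (simp add: of_bool_cong_floor_eq sum.distrib sum_subtractf)
  finally have eq: "real (card {n \<in> dyadic X. [nat \<lfloor>real n powr c\<rfloor> = b] (mod q)})
      - real (card (dyadic X)) / real q
    = (\<Sum>n\<in>dyadic X. saw (real n powr c / real q - (real b + 1) / real q))
      - (\<Sum>n\<in>dyadic X. saw (real n powr c / real q - real b / real q))"
    by simp
  have "\<bar>x - y\<bar> \<le> 2 * K * Z" if "\<bar>x\<bar> \<le> K * Z" "\<bar>y\<bar> \<le> K * Z" for x y K Z :: real
    using that by linarith
  then show ?thesis
    unfolding eq by this (rule abs_sum_saw_powr_le[OF c X q])+
qed

section \<open>Square divisors of \<open>m * (m + 1)\<close>\<close>

abbreviation omega :: "nat \<Rightarrow> nat" where
  "omega d \<equiv> card (prime_factors d)"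

section \<open>Products of distinct primes and a divisor bound\<close>

lemma prod_coprime_dvd:
  fixes f :: "'a \<Rightarrow> nat"
  assumes "finite A" "\<And>i j. i \<in> A \<Longrightarrow> j \<in> A \<Longrightarrow> i \<noteq> j \<Longrightarrow> coprime (f i) (f j)"
    and "\<And>i. i \<in> A \<Longrightarrow> f i dvd k"
  shows "prod f A dvd k"
  using assms
proof (induction A rule: finite_induct)
  case (insert i A)
  have "coprime (f i) (prod f A)"
    using insert.hyps insert.prems(1) by (intro prod_coprime_right) auto
  then show ?case
    using insert by (simp add: divides_mult)
qed simp

lemma prod_primes_power_dvd:
  fixes A :: "nat set"
  assumes "finite A" "\<And>p. p \<in> A \<Longrightarrow> prime p" "\<And>p. p \<in> A \<Longrightarrow> p ^ e dvd k"
  shows "(\<Prod>A) ^ e dvd k"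
  unfolding prod_power_distrib
  using assms by (intro prod_coprime_dvd) (auto intro!: coprime_power_left_iff[THEN iffD2] coprime_power_right_iff[THEN iffD2] simp: primes_coprime)

lemma
  fixes A :: "nat set"
  assumes "finite A" "\<And>p. p \<in> A \<Longrightarrow> prime p"
  shows prime_factors_prod_primes: "prime_factors (\<Prod>A) = A"
    and squarefree_prod_primes: "squarefree (\<Prod>A)"
proof -
  have "prime_factors (\<Prod>A) = (\<Union>p\<in>A. prime_factors p)"
    using assms assms(2)[of 0] by (subst prime_factors_prod) auto
  also have "\<dots> = A"
    using assms(2) by (auto simp: prime_prime_factors)
  finally show "prime_factors (\<Prod>A) = A" .
  show "squarefree (\<Prod>A)"
    using assms(2) by (intro squarefree_prod_coprime) (auto simp: primes_coprime squarefree_prime)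
qed

lemma prod_prime_factors_squarefree:
  fixes d :: nat
  assumes "squarefree d"
  shows "\<Prod>(prime_factors d) = d"
proof -
  have d: "d \<noteq> 0"
    using assms by (metis not_squarefree_0)
  have "\<Prod>(prime_factors d) = (\<Prod>p\<in>prime_factors d. p ^ multiplicity p d)"
    using assms d by (intro prod.cong) (auto simp: squarefree_factorial_semiring')
  also have "\<dots> = d"
    using d by (simp add: prime_factorization_nat[symmetric])
  finally show ?thesis .
qed

text \<open>The primes below T contribute at most \<open>2 ^ T\<close>. Every larger prime satisfies
  \<open>2 \<le> p powr \<eta>\<close>, and the product of the larger primes dividing k divides
  k.\<close>

lemma omega_le_powr:
  fixes \<eta> :: real
  assumes "\<eta> > 0"
  obtains C where "C \<ge> 1" "\<And>k. k > 0 \<Longrightarrow> 2 ^ omega k \<le> C * real k powr \<eta>"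
proof -
  define T where "T = nat \<lceil>2 powr (1 / \<eta>)\<rceil>"
  have "2 ^ omega k \<le> 2 ^ T * real k powr \<eta>" if k: "k > 0" for k
  proof -
    define A where "A = {p \<in> prime_factors k. T \<le> p}"
    have fin: "finite A"
      unfolding A_def by simp
    have pr: "prime p" if "p \<in> A" for p
      using that by (auto simp: A_def)
    have "prime_factors k \<subseteq> {..<T} \<union> A"
      by (auto simp: A_def)
    then have "omega k \<le> card ({..<T} \<union> A)"
      using fin by (intro card_mono) auto
    also have "\<dots> \<le> T + card A"
      using card_Un_le[of "{..<T}" A] by simp
    finally have "(2::real) ^ omega k \<le> 2 ^ (T + card A)"
      by (intro power_increasing) auto
    also have "\<dots> = 2 ^ T * (\<Prod>p\<in>A. 2)"
      by (simp add: power_add)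
    also have "\<dots> \<le> 2 ^ T * (\<Prod>p\<in>A. real p powr \<eta>)"
    proof (intro mult_left_mono prod_mono conjI)
      fix p assume "p \<in> A"
      then have "2 powr (1 / \<eta>) \<le> real p"
        by (auto simp: A_def T_def nat_le_iff ceiling_le_iff)
      then have "(2 powr (1 / \<eta>)) powr \<eta> \<le> real p powr \<eta>"
        using assms by (intro powr_mono2) auto
      then show "2 \<le> real p powr \<eta>"
        using assms by (simp add: powr_powr)
    qed auto
    also have "(\<Prod>p\<in>A. real p powr \<eta>) = real (\<Prod>A) powr \<eta>"
      using fin by (induction A rule: finite_induct) (auto simp: powr_mult prod_nonneg)
    also have "\<dots> \<le> real k powr \<eta>"
    proof -
      have "(\<Prod>A) ^ 1 dvd k"
        using fin pr by (intro prod_primes_power_dvd) (auto simp: A_def)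
      then have "\<Prod>A \<le> k"
        using k by (simp add: dvd_imp_le)
      then show ?thesis
        using assms by (intro powr_mono2) (auto simp del: of_nat_prod)
    qed
    finally show ?thesis
      by simp
  qed
  then show ?thesis
    using that[of "2 ^ T"] by simp
qed

section \<open>Moebius sums over square divisors\<close>

definition sq_primes :: "nat \<Rightarrow> nat set" where
  "sq_primes k = {p. prime p \<and> p\<^sup>2 dvd k}"

lemma sq_primes_subset: "k > 0 \<Longrightarrow> sq_primes k \<subseteq> prime_factors k"
  by (auto simp: sq_primes_def prime_factors_dvd intro: dvd_trans[OF dvd_power[of 2]])

lemma finite_sq_primes: "k > 0 \<Longrightarrow> finite (sq_primes k)"
  using sq_primes_subset finite_subset by blast

lemma inj_on_prod_primes:
  fixes Q :: "nat set"
  assumes "\<And>p. p \<in> Q \<Longrightarrow> prime p" "finite Q"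
  shows "inj_on Prod (Pow Q)"
proof (rule inj_onI)
  fix A B assume AB: "A \<in> Pow Q" "B \<in> Pow Q" "\<Prod>A = \<Prod>B"
  have "prime_factors (\<Prod>A) = A" if "A \<in> Pow Q" for A
    using that assms by (intro prime_factors_prod_primes) (auto intro: finite_subset)
  with AB show "A = B"
    by metis
qed

text \<open>A square-free d is the product of its primes, and \<open>d^2\<close> divides k exactly
  when the square of each of them does. Sums over d thereby become sums over sets of primes.\<close>

lemma squarefree_square_divisors_eq:
  assumes k: "k > 0"
  shows "{d. squarefree d \<and> d\<^sup>2 dvd k} = Prod ` Pow (sq_primes k)"
proof (intro equalityI subsetI)
  fix d assume "d \<in> {d. squarefree d \<and> d\<^sup>2 dvd k}"
  then have d: "squarefree d" "d\<^sup>2 dvd k"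
    by auto
  have "prime_factors d \<subseteq> sq_primes k"
    using d(2) by (auto simp: sq_primes_def intro: dvd_trans[OF dvd_power_same])
  then show "d \<in> Prod ` Pow (sq_primes k)"
    using prod_prime_factors_squarefree[OF d(1)] by (metis PowI image_eqI)
next
  fix d assume "d \<in> Prod ` Pow (sq_primes k)"
  then obtain A where A: "A \<subseteq> sq_primes k" "d = \<Prod>A"
    by auto
  then have "finite A" "\<And>p. p \<in> A \<Longrightarrow> prime p" "\<And>p. p \<in> A \<Longrightarrow> p\<^sup>2 dvd k"
    using finite_sq_primes[OF k] finite_subset by (auto simp: sq_primes_def)
  then show "d \<in> {d. squarefree d \<and> d\<^sup>2 dvd k}"
    using prod_primes_power_dvd[of A 2 k] squarefree_prod_primes[of A] A(2) by simp
qed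

lemma
  assumes k: "k > 0"
  shows finite_squarefree_square_divisors: "finite {d. squarefree d \<and> d\<^sup>2 dvd k}"
    and card_squarefree_square_divisors_le: "card {d. squarefree d \<and> d\<^sup>2 dvd k} \<le> 2 ^ omega k"
proof -
  show "finite {d. squarefree d \<and> d\<^sup>2 dvd k}"
    using finite_sq_primes[OF k] by (simp add: squarefree_square_divisors_eq[OF k])
  have "card {d. squarefree d \<and> d\<^sup>2 dvd k} \<le> card (Pow (sq_primes k))"
    using finite_sq_primes[OF k] by (simp add: squarefree_square_divisors_eq[OF k] card_image_le)
  also have "\<dots> \<le> 2 ^ omega k"
    using sq_primes_subset[OF k] finite_sq_primes[OF k]
    by (simp add: card_Pow card_mono)
  finally show "card {d. squarefree d \<and> d\<^sup>2 dvd k} \<le> 2 ^ omega k" .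
qed

lemma moebius_mu_prod_primes:
  assumes "finite A" "\<And>p. p \<in> A \<Longrightarrow> prime p"
  shows "moebius_mu (\<Prod>A) = (-1) ^ card A"
  using assms by (simp add: moebius_mu_def squarefree_prod_primes prime_factors_prod_primes)

text \<open>As a sum over subsets this is the expansion of \<open>(1 - 1) ^ n\<close>, where n
  counts the primes whose square divides k; it is 1 for \<open>n = 0\<close> and 0
  otherwise.\<close>

lemma sum_moebius_mu_square_divisors:
  assumes k: "k > 0"
  shows "(\<Sum>d | squarefree d \<and> d\<^sup>2 dvd k. moebius_mu d) = of_bool (squarefree k)"
proof -
  have fin: "finite (sq_primes k)" and pr: "\<And>p. p \<in> sq_primes k \<Longrightarrow> prime p"
    using finite_sq_primes[OF k] by (auto simp: sq_primes_def)
  have "(\<Sum>d | squarefree d \<and> d\<^sup>2 dvd k. moebius_mu d) = (\<Sum>A\<in>Pow (sq_primes k). moebius_mu (\<Prod>A))"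
    unfolding squarefree_square_divisors_eq[OF k]
    using inj_on_prod_primes[OF pr fin] by (simp add: sum.reindex)
  also have "\<dots> = (\<Sum>A\<in>Pow (sq_primes k). (-1) ^ card A)"
    using fin pr by (intro sum.cong refl moebius_mu_prod_primes) (auto intro: finite_subset)
  also have "\<dots> = (\<Prod>p\<in>sq_primes k. 1 - 1)"
    using prod_diff_conv_sum[OF fin, of "\<lambda>_. 1 :: int" "\<lambda>_. 1"] by simp
  also have "\<dots> = of_bool (sq_primes k = {})"
    using fin by (simp add: power_0_left)
  also have "sq_primes k = {} \<longleftrightarrow> squarefree k"
    using k by (auto simp: sq_primes_def squarefree_factorial_semiring)
  finally show ?thesis .
qed

section \<open>Roots of \<open>m * (m + 1)\<close> modulo \<open>d^2\<close>\<close>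

lemma squarefree_mult_Suc_iff: "squarefree (m * (m + 1)) \<longleftrightarrow> squarefree m \<and> squarefree (m + 1)" for m :: nat
  by (metis coprime_Suc_right_nat Suc_eq_plus1 squarefree_mult_coprime squarefree_multD)

text \<open>A prime cannot divide two consecutive numbers, so the factor it does not divide is
  coprime to \<open>p^2\<close> and cancels.\<close>

lemma prime_square_dvd_mult_SucD:
  fixes p m :: nat
  assumes "prime p" "p\<^sup>2 dvd m * (m + 1)"
  shows "p dvd m \<Longrightarrow> p\<^sup>2 dvd m" "\<not> p dvd m \<Longrightarrow> p\<^sup>2 dvd m + 1"
proof -
  assume "p dvd m"
  then have "\<not> p dvd m + 1"
    using assms(1) by (metis dvd_add_right_iff not_prime_unit)
  then have "coprime (p\<^sup>2) (m + 1)"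
    using assms(1) prime_imp_coprime_nat by auto
  with assms(2) show "p\<^sup>2 dvd m"
    using coprime_dvd_mult_left_iff by blast
next
  assume "\<not> p dvd m"
  then have "coprime (p\<^sup>2) m"
    using assms(1) prime_imp_coprime_nat by auto
  with assms(2) show "p\<^sup>2 dvd m + 1"
    using coprime_dvd_mult_right_iff by blast
qed

text \<open>Least residues are taken as representatives, so each m is congruent to at most one
  element.\<close>

definition sq_roots :: "nat \<Rightarrow> nat set" where
  "sq_roots d = {b. b < d\<^sup>2 \<and> d\<^sup>2 dvd b * (b + 1)}"

lemma finite_sq_roots: "finite (sq_roots d)"
  by (rule finite_subset[of _ "{..<d\<^sup>2}"]) (auto simp: sq_roots_def)

lemma cong_mult_Suc: "[m = m'] (mod q) \<Longrightarrow> [m * (m + 1) = m' * (m' + 1)] (mod q)" for m m' q :: nat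
  by (intro cong_mult cong_add cong_refl)

text \<open>The bijection sends a root b to the set of those prime divisors of d that divide b
  (the others divide \<open>b + 1\<close>).\<close>

lemma card_sq_roots:
  assumes d: "squarefree d"
  shows "card (sq_roots d) = 2 ^ omega d"
proof -
  define P where "P = prime_factors d"
  define \<phi> where "\<phi> b = {p \<in> P. p dvd b}" for b :: nat
  have fin: "finite P" and pr: "\<And>p. p \<in> P \<Longrightarrow> prime p" and dP: "d = \<Prod>P"
    using prod_prime_factors_squarefree[OF d] by (auto simp: P_def)
  have d2: "d\<^sup>2 = (\<Prod>p\<in>P. p\<^sup>2)"
    unfolding dP by (simp add: prod_power_distrib)
  have cop: "coprime (p\<^sup>2) (q\<^sup>2)" if "p \<in> P" "q \<in> P" "p \<noteq> q" for p q
    using that pr by (simp add: primes_coprime)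
  have p_dvd: "p\<^sup>2 dvd b * (b + 1)" if "b \<in> sq_roots d" "p \<in> P" for b p
    using that by (auto simp: sq_roots_def P_def intro: dvd_trans[OF dvd_power_same])
  have "bij_betw \<phi> (sq_roots d) (Pow P)"
    unfolding bij_betw_def
  proof
    show "inj_on \<phi> (sq_roots d)"
    proof (rule inj_onI)
      fix b b' assume b: "b \<in> sq_roots d" "b' \<in> sq_roots d" "\<phi> b = \<phi> b'"
      have "[b = b'] (mod p\<^sup>2)" if p: "p \<in> P" for p
      proof (cases "p dvd b")
        case True
        then have "p dvd b'"
          using b(3) p by (auto simp: \<phi>_def)
        then have "p\<^sup>2 dvd b" "p\<^sup>2 dvd b'"
          using True prime_square_dvd_mult_SucD(1) pr p_dvd b p by blast+
        then show ?thesis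
          by (simp add: cong_def)
      next
        case False
        then have "\<not> p dvd b'"
          using b(3) p by (auto simp: \<phi>_def)
        then have "p\<^sup>2 dvd b + 1" "p\<^sup>2 dvd b' + 1"
          using False prime_square_dvd_mult_SucD(2) pr p_dvd b p by blast+
        then have "[b + 1 = b' + 1] (mod p\<^sup>2)"
          by (simp add: cong_def)
        then show ?thesis
          using cong_add_rcancel_nat by blast
      qed
      then have "[b = b'] (mod (\<Prod>p\<in>P. p\<^sup>2))"
        using cop by (intro coprime_cong_prod_nat) auto
      then show "b = b'"
        using b(1,2) by (auto simp: sq_roots_def d2 cong_less_modulus_unique_nat)
    qed
    show "\<phi> ` sq_roots d = Pow P"
    proof (intro equalityI subsetI)
      fix B assume "B \<in> Pow P"
      then have B: "B \<subseteq> P"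
        by simp
      have "\<forall>p\<in>P. p\<^sup>2 \<noteq> 0"
        by (metis pr not_prime_0 power_not_zero)
      \<comment> \<open>The Chinese remainder theorem is applied to the residues 0 for p in B and -1
        for the other p; over the naturals -1 becomes \<open>p^2 - 1\<close>.\<close>
      then have "\<exists>!b. b < (\<Prod>p\<in>P. p\<^sup>2)
          \<and> (\<forall>p\<in>P. [b = (if p \<in> B then 0 else p\<^sup>2 - 1)] (mod p\<^sup>2))"
        using cop by (intro chinese_remainder_unique_nat fin) auto
      then obtain b where b: "b < (\<Prod>p\<in>P. p\<^sup>2)"
        "\<forall>p\<in>P. [b = (if p \<in> B then 0 else p\<^sup>2 - 1)] (mod p\<^sup>2)"
        by (elim ex1E conjE)
      have in_B: "p\<^sup>2 dvd b" if "p \<in> B" for p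
        using bspec[OF b(2), of p] B that by (auto simp: cong_0_iff)
      have not_in_B: "p\<^sup>2 dvd b + 1" if "p \<in> P" "p \<notin> B" for p
      proof -
        have "[b + 1 = p\<^sup>2 - 1 + 1] (mod p\<^sup>2)"
          using bspec[OF b(2) that(1)] that(2) by (intro cong_add) auto
        moreover have "p\<^sup>2 - 1 + 1 = p\<^sup>2"
          using pr[OF that(1)] prime_gt_0_nat[of p] by simp
        ultimately show ?thesis
          by (simp add: cong_def dvd_eq_mod_eq_0)
      qed
      have "(\<Prod>p\<in>P. p\<^sup>2) dvd b * (b + 1)"
      proof (rule prod_coprime_dvd[OF fin cop])
        show "p\<^sup>2 dvd b * (b + 1)" if "p \<in> P" for p
          using in_B not_in_B[OF that] dvd_mult dvd_mult2 by blast
      qed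
      then have "b \<in> sq_roots d"
        using b(1) by (simp add: sq_roots_def d2)
      moreover have "\<phi> b = B"
      proof -
        have "p dvd b \<longleftrightarrow> p \<in> B" if p: "p \<in> P" for p
        proof
          assume "p \<in> B"
          then show "p dvd b"
            using in_B by (auto intro: dvd_trans[OF dvd_power[of 2]])
        next
          assume "p dvd b"
          then have "\<not> p dvd b + 1"
            using pr[OF p] by (metis dvd_add_right_iff not_prime_unit)
          then show "p \<in> B"
            using not_in_B[OF p] by (auto intro: dvd_trans[OF dvd_power[of 2]])
        qed
        then show ?thesis
          using B by (auto simp: \<phi>_def)
      qed
      ultimately show "B \<in> \<phi> ` sq_roots d"
        by blast
    qed (auto simp: \<phi>_def)
  qed
  then show ?thesis
    using bij_betw_same_card fin by (metis card_Pow P_def)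
qed

text \<open>Divisibility depends only on \<open>m mod d^2\<close>, and the only root that can
  contribute to the sum is this residue itself.\<close>

lemma of_bool_square_dvd_mult_Suc:
  assumes "d > 0"
  shows "of_bool (d\<^sup>2 dvd m * (m + 1)) = (\<Sum>b\<in>sq_roots d. of_bool ([m = b] (mod d\<^sup>2)) :: real)"
proof -
  have iff: "[m = b] (mod d\<^sup>2) \<longleftrightarrow> b = m mod d\<^sup>2" if "b \<in> sq_roots d" for b
    using that by (auto simp: sq_roots_def cong_def)
  have "(\<Sum>b\<in>sq_roots d. of_bool ([m = b] (mod d\<^sup>2)) :: real) = (\<Sum>b\<in>sq_roots d. of_bool (b = m mod d\<^sup>2))"
    using iff by (intro sum.cong) auto
  also have "\<dots> = of_bool (m mod d\<^sup>2 \<in> sq_roots d)"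
    using finite_sq_roots by (simp add: of_bool_def)
  also have "m mod d\<^sup>2 \<in> sq_roots d \<longleftrightarrow> d\<^sup>2 dvd m * (m + 1)"
    using assms cong_dvd_iff[OF cong_mult_Suc[of "m mod d\<^sup>2" m "d\<^sup>2"]]
    by (simp add: sq_roots_def cong_def)
  finally show ?thesis
    by simp
qed

section \<open>Convergence of the Euler product\<close>

lemma sum_powr_tail_le:
  fixes \<eta> :: real and w :: nat
  assumes \<eta>: "\<eta> \<le> 1 / 2" and w: "w > 0" and F: "finite F" "F \<subseteq> {w<..}"
  shows "(\<Sum>d\<in>F. real d powr (\<eta> - 2)) \<le> 2 * real w powr (\<eta> - 1)"
proof -
  \<comment> \<open>The mean value theorem bounds the term by a telescoping difference divided by
    \<open>1 - \<eta>\<close>; as \<open>\<eta> \<le> 1 / 2\<close>, the factor 2 suffices.\<close>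
  have diff: "real (Suc d) powr (\<eta> - 2) \<le> 2 * (real d powr (\<eta> - 1) - real (Suc d) powr (\<eta> - 1))"
    if "d > 0" for d
  proof -
    have d: "0 < real d" "real d \<le> real (Suc d)"
      using that by auto
    obtain z where z: "real d \<le> z" "z \<le> real (Suc d)"
      "real (Suc d) powr (\<eta> - 1) - real d powr (\<eta> - 1) = (real (Suc d) - real d) * ((\<eta> - 1) * z powr (\<eta> - 1 - 1))"
      by (rule powr_mean_value[OF d])
    have "real (Suc d) powr (\<eta> - 2) \<le> z powr (\<eta> - 2)"
      using z \<eta> that by (intro powr_mono2') auto
    also have "\<dots> \<le> 2 * (1 - \<eta>) * z powr (\<eta> - 2)"
      using \<eta> mult_right_mono[of 1 "2 * (1 - \<eta>)" "z powr (\<eta> - 2)"] by simp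
    also have "\<dots> = 2 * (real d powr (\<eta> - 1) - real (Suc d) powr (\<eta> - 1))"
      using z(3) by (simp add: algebra_simps)
    finally show ?thesis .
  qed
  have tele: "(\<Sum>d\<in>{w<..n}. real d powr (\<eta> - 2)) \<le> 2 * (real w powr (\<eta> - 1) - real n powr (\<eta> - 1))"
    if "w \<le> n" for n
    using that
  proof (induction n rule: dec_induct)
    case (step n)
    have "{w<..Suc n} = insert (Suc n) {w<..n}"
      using step.hyps by auto
    then show ?case
      using step.IH step.hyps w diff[of n] by simp
  qed simp
  define n where "n = Max (insert w F)"
  have n: "w \<le> n" "F \<subseteq> {w<..n}"
    using F by (auto simp: n_def)
  have "(\<Sum>d\<in>F. real d powr (\<eta> - 2)) \<le> (\<Sum>d\<in>{w<..n}. real d powr (\<eta> - 2))"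
    using n by (intro sum_mono2) auto
  also have "\<dots> \<le> 2 * real w powr (\<eta> - 1)"
    by (rule order_trans[OF tele[OF n(1)]]) simp
  finally show ?thesis .
qed

text \<open>For square-free d, \<open>2 ^ omega d / d^2\<close> is the density of the m with
  \<open>d^2\<close> dividing \<open>m * (m + 1)\<close>. Weighted by the Moebius function these
  densities sum to \<open>sigma_const\<close>.\<close>

definition sieve_coeff :: "nat \<Rightarrow> real" where
  "sieve_coeff d = of_int (moebius_mu d) * 2 ^ omega d / (real d)\<^sup>2"

lemma abs_moebius_mu_le: "\<bar>real_of_int (moebius_mu d)\<bar> \<le> 1"
  by (simp add: moebius_mu_def power_abs)

lemma abs_sieve_coeff_le:
  assumes "d > 0" "2 ^ omega d \<le> C * real d powr \<eta>"
  shows "\<bar>sieve_coeff d\<bar> \<le> C * real d powr (\<eta> - 2)"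
proof -
  have "\<bar>sieve_coeff d\<bar> = \<bar>real_of_int (moebius_mu d)\<bar> * (2 ^ omega d / (real d)\<^sup>2)"
    by (simp add: sieve_coeff_def abs_mult)
  also have "\<dots> \<le> 1 * (C * real d powr \<eta> / (real d)\<^sup>2)"
    using assms by (intro mult_mono divide_right_mono abs_moebius_mu_le) auto
  also have "\<dots> = C * real d powr (\<eta> - 2)"
    using assms by (simp add: powr_diff powr_realpow)
  finally show ?thesis .
qed

text \<open>Expanding the product, a set A of primes yields the sign \<open>(-1) ^ card A\<close>
  and the numerator \<open>2 ^ card A\<close>, which are the Moebius value and
  \<open>2 ^ omega\<close> of the product of A.\<close>

lemma prod_euler_eq_sum_sieve_coeff:
  fixes n :: nat
  defines "P \<equiv> {p. prime p \<and> p \<le> n}"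
  shows "(\<Prod>p\<le>n. if prime p then 1 - 2 / (real p)\<^sup>2 else 1) = (\<Sum>d\<in>Prod ` Pow P. sieve_coeff d)"
proof -
  have fin: "finite P" and pr: "\<And>p. p \<in> P \<Longrightarrow> prime p"
    by (auto simp: P_def)
  have "(\<Prod>p\<le>n. if prime p then 1 - 2 / (real p)\<^sup>2 else 1) = (\<Prod>p\<in>P. 1 - 2 / (real p)\<^sup>2)"
    by (rule prod.mono_neutral_cong_right) (auto simp: P_def)
  also have "\<dots> = (\<Sum>A\<in>Pow P. (-1) ^ card A * (\<Prod>p\<in>A. 2 / (real p)\<^sup>2))"
    using prod_diff_conv_sum[OF fin, of "\<lambda>_. 1 :: real" "\<lambda>p. 2 / (real p)\<^sup>2"] by simp
  also have "\<dots> = (\<Sum>A\<in>Pow P. sieve_coeff (\<Prod>A))"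
  proof (intro sum.cong refl)
    fix A assume "A \<in> Pow P"
    then have A: "finite A" "\<And>p. p \<in> A \<Longrightarrow> prime p"
      using fin pr finite_subset by auto
    then show "(-1) ^ card A * (\<Prod>p\<in>A. 2 / (real p)\<^sup>2) = sieve_coeff (\<Prod>A)"
      by (simp add: sieve_coeff_def moebius_mu_prod_primes prime_factors_prod_primes
          prod_dividef prod_power_distrib)
  qed
  also have "\<dots> = (\<Sum>d\<in>Prod ` Pow P. sieve_coeff d)"
    using inj_on_prod_primes[OF pr fin] by (simp add: sum.reindex)
  finally show ?thesis .
qed

text \<open>Convergence follows from the summability of \<open>2 / p^2\<close> together with the
  fact that no factor vanishes: \<open>p^2 = 2\<close> is impossible.\<close>

lemma sigma_const_LIMSEQ:
  "(\<lambda>n. \<Prod>p\<le>n. if prime p then 1 - 2 / (real p)\<^sup>2 else 1) \<longlonglongrightarrow> sigma_const"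
proof -
  define z :: "nat \<Rightarrow> real" where "z p = (if prime p then - 2 / (real p)\<^sup>2 else 0)" for p
  have "summable (\<lambda>p. \<bar>z p\<bar>)"
  proof (rule summable_comparison_test)
    show "summable (\<lambda>p. 2 * inverse (real p ^ 2))"
      by (intro summable_mult inverse_power_summable) auto
    show "\<exists>N. \<forall>n\<ge>N. norm \<bar>z n\<bar> \<le> 2 * inverse (real n ^ 2)"
      by (auto simp: z_def field_simps)
  qed
  moreover have "z p \<noteq> - 1" for p
  proof
    assume "z p = - 1"
    then have p: "prime p" "(real p)\<^sup>2 = 2"
      by (auto simp: z_def field_simps split: if_splits)
    have "2\<^sup>2 \<le> (real p)\<^sup>2"
      using prime_ge_2_nat[OF p(1)] by (intro power_mono) auto
    with p(2) show False
      by simp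
  qed
  ultimately have "convergent_prod (\<lambda>p. 1 + z p)"
    by (intro summable_imp_convergent_prod_real) auto
  also have "(\<lambda>p. 1 + z p) = (\<lambda>p. if prime p then 1 - 2 / (real p)\<^sup>2 else 1)"
    by (auto simp: z_def)
  finally show ?thesis
    unfolding sigma_const_def by (rule convergent_prod_LIMSEQ)
qed

text \<open>The partial product up to n is a sum over the square-free d built from primes up to n.
  For \<open>n \<ge> w\<close> these include all square-free \<open>d \<le> w\<close>, so the
  difference is a tail over \<open>d > w\<close>, bounded uniformly in n.\<close>

lemma sigma_const_approx:
  fixes w :: nat and C \<eta> :: real
  assumes C: "\<And>k. k > 0 \<Longrightarrow> 2 ^ omega k \<le> C * real k powr \<eta>" "C \<ge> 0"
    and \<eta>: "\<eta> \<le> 1 / 2" and w: "w > 0"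
  shows "\<bar>sigma_const - (\<Sum>d\<in>{1..w}. sieve_coeff d)\<bar> \<le> 2 * C * real w powr (\<eta> - 1)"
proof (rule LIMSEQ_le_const2)
  show "(\<lambda>n. \<bar>(\<Prod>p\<le>n. if prime p then 1 - 2 / (real p)\<^sup>2 else 1) - (\<Sum>d\<in>{1..w}. sieve_coeff d)\<bar>)
      \<longlonglongrightarrow> \<bar>sigma_const - (\<Sum>d\<in>{1..w}. sieve_coeff d)\<bar>"
    by (intro tendsto_intros sigma_const_LIMSEQ)
  show "\<exists>N. \<forall>n\<ge>N. \<bar>(\<Prod>p\<le>n. if prime p then 1 - 2 / (real p)\<^sup>2 else 1) - (\<Sum>d\<in>{1..w}. sieve_coeff d)\<bar>
      \<le> 2 * C * real w powr (\<eta> - 1)"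
  proof (intro exI allI impI)
    fix n assume n: "n \<ge> w"
    define P where "P = {p. prime p \<and> p \<le> n}"
    define D where "D = Prod ` Pow P"
    have finP: "finite P"
      by (simp add: P_def)
    then have fin: "finite D"
      by (simp add: D_def)
    have pos: "d > 0" if "d \<in> D" for d
    proof -
      obtain A where A: "A \<in> Pow P" "d = \<Prod>A"
        using \<open>d \<in> D\<close> unfolding D_def by (rule imageE)
      then have "p > 0" if "p \<in> A" for p
        using that by (auto simp: P_def prime_gt_0_nat)
      then show ?thesis
        unfolding A(2) by (intro prod_pos) auto
    qed
    have mem: "d \<in> D" if "d \<in> {1..w}" "squarefree d" for d
    proof -
      have "prime_factors d \<subseteq> P"
        using that(1) n by (auto simp: P_def dest!: dvd_imp_le)
      then show ?thesis
        using prod_prime_factors_squarefree[OF that(2)] unfolding D_def by (metis PowI image_eqI)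
    qed
    have "(\<Sum>d\<in>{1..w}. sieve_coeff d) = (\<Sum>d\<in>D \<inter> {1..w}. sieve_coeff d)"
      by (rule sum.mono_neutral_right) (use mem in \<open>auto simp: sieve_coeff_def moebius_mu_def\<close>)
    moreover have "(\<Sum>d\<in>D. sieve_coeff d) = (\<Sum>d\<in>D \<inter> {1..w}. sieve_coeff d) + (\<Sum>d\<in>D - {1..w}. sieve_coeff d)"
      using fin by (rule sum.Int_Diff)
    ultimately have "\<bar>(\<Prod>p\<le>n. if prime p then 1 - 2 / (real p)\<^sup>2 else 1) - (\<Sum>d\<in>{1..w}. sieve_coeff d)\<bar>
        = \<bar>\<Sum>d\<in>D - {1..w}. sieve_coeff d\<bar>"
      unfolding prod_euler_eq_sum_sieve_coeff P_def[symmetric] D_def[symmetric] by simp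
    also have "\<dots> \<le> (\<Sum>d\<in>D - {1..w}. C * real d powr (\<eta> - 2))"
      using pos by (intro order_trans[OF sum_abs] sum_mono abs_sieve_coeff_le C) auto
    also have "\<dots> = C * (\<Sum>d\<in>D - {1..w}. real d powr (\<eta> - 2))"
      by (simp add: sum_distrib_left)
    also have "\<dots> \<le> C * (2 * real w powr (\<eta> - 1))"
    proof (intro mult_left_mono C sum_powr_tail_le \<eta> w)
      show "D - {1..w} \<subseteq> {w<..}"
        using pos by (force simp: Suc_le_eq)
    qed (use fin in auto)
    finally show "\<bar>(\<Prod>p\<le>n. if prime p then 1 - 2 / (real p)\<^sup>2 else 1) - (\<Sum>d\<in>{1..w}. sieve_coeff d)\<bar>
        \<le> 2 * C * real w powr (\<eta> - 1)"
      by simp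
  qed
qed

section \<open>Counting m with a large square divisor\<close>

lemma card_multiples_le:
  fixes q N :: nat
  assumes "q > 0"
  shows "real (card {m \<in> {1..N}. q dvd m}) \<le> real N / real q"
proof -
  have "{m \<in> {1..N}. q dvd m} \<subseteq> (\<lambda>k. q * k) ` {1..N div q}"
    using assms by (auto simp: less_eq_div_iff_mult_less_eq mult.commute elim!: dvdE)
  then have "card {m \<in> {1..N}. q dvd m} \<le> card ((\<lambda>k. q * k) ` {1..N div q})"
    by (intro card_mono) auto
  also have "\<dots> \<le> N div q"
    using card_image_le[of "{1..N div q}" "\<lambda>k. q * k"] by simp
  finally have "real (card {m \<in> {1..N}. q dvd m}) \<le> real (N div q)"
    by simp
  also have "\<dots> \<le> real N / real q"
    by (rule of_nat_div_le_of_nat)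
  finally show ?thesis .
qed

text \<open>Distinct members of one residue class are at least q apart.\<close>

lemma card_cong_le:
  fixes q N b :: nat
  assumes "q > 0"
  shows "real (card {m \<in> {1..N}. [m = b] (mod q)}) \<le> real N / real q + 1"
proof (rule card_separated_le)
  show "n + q \<le> n'" if "n \<in> {m \<in> {1..N}. [m = b] (mod q)}" "n' \<in> {m \<in> {1..N}. [m = b] (mod q)}" "n < n'" for n n'
  proof -
    have "[n' = n] (mod q)"
      using that by (auto intro: cong_trans cong_sym)
    then have "q dvd n' - n"
      using that(3) cong_altdef_nat[of n n' q] by simp
    then show ?thesis
      using that(3) dvd_imp_le[of q "n' - n"] by simp
  qed
qed (use assms in auto)

lemma card_square_dvd_mult_Suc_le:
  assumes d: "squarefree d"
  shows "real (card {m \<in> {1..N}. d\<^sup>2 dvd m * (m + 1)}) \<le> 2 ^ omega d * (real N / (real d)\<^sup>2 + 1)"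
proof -
  have d0: "d > 0"
    using d not_squarefree_0 by (metis gr0I)
  have "real (card {m \<in> {1..N}. d\<^sup>2 dvd m * (m + 1)}) = (\<Sum>m\<in>{1..N}. of_bool (d\<^sup>2 dvd m * (m + 1)))"
    by (simp add: sum.If_cases Int_def of_bool_def)
  also have "\<dots> = (\<Sum>m\<in>{1..N}. \<Sum>b\<in>sq_roots d. of_bool ([m = b] (mod d\<^sup>2)))"
    by (intro sum.cong refl of_bool_square_dvd_mult_Suc d0)
  also have "\<dots> = (\<Sum>b\<in>sq_roots d. \<Sum>m\<in>{1..N}. of_bool ([m = b] (mod d\<^sup>2)))"
    by (rule sum.swap)
  also have "\<dots> = (\<Sum>b\<in>sq_roots d. real (card {m \<in> {1..N}. [m = b] (mod d\<^sup>2)}))"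
    by (intro sum.cong refl) (simp add: sum.If_cases Int_def of_bool_def)
  also have "\<dots> \<le> (\<Sum>b\<in>sq_roots d. real N / (real d)\<^sup>2 + 1)"
    using card_cong_le[of "d\<^sup>2" N] d0 by (intro sum_mono) simp
  also have "\<dots> = 2 ^ omega d * (real N / (real d)\<^sup>2 + 1)"
    by (simp add: card_sq_roots[OF d])
  finally show ?thesis .
qed

text \<open>The primes of d are sorted by whether they divide m: those that do make up
  \<open>d1\<close>, and the others, which divide \<open>m + 1\<close>, make up
  \<open>d2\<close>.\<close>

lemma squarefree_square_dvd_mult_SucE:
  fixes d m :: nat
  assumes "squarefree d" "d\<^sup>2 dvd m * (m + 1)"
  obtains d1 d2 where "d = d1 * d2" "d1\<^sup>2 dvd m" "d2\<^sup>2 dvd m + 1"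
proof
  define P where "P = prime_factors d"
  define A where "A = {p \<in> P. p dvd m}"
  have pr: "prime p" "p\<^sup>2 dvd m * (m + 1)" if "p \<in> P" for p
    using that assms(2) by (auto simp: P_def intro: dvd_trans[OF dvd_power_same])
  have AP: "A \<subseteq> P" and fin: "finite P"
    by (auto simp: A_def P_def)
  show "d = \<Prod>A * \<Prod>(P - A)"
    using prod_prime_factors_squarefree[OF assms(1)] prod.subset_diff[OF AP fin, of "\<lambda>p. p"]
    unfolding P_def by (simp add: mult.commute)
  show "(\<Prod>A)\<^sup>2 dvd m"
  proof (rule prod_primes_power_dvd)
    show "p\<^sup>2 dvd m" if "p \<in> A" for p
      using that pr[of p] prime_square_dvd_mult_SucD(1)[of p m] unfolding A_def by blast
    show "finite A"
      using fin by (simp add: A_def)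
    show "prime p" if "p \<in> A" for p
      using that pr(1)[of p] by (simp add: A_def)
  qed
  show "(\<Prod>(P - A))\<^sup>2 dvd m + 1"
  proof (rule prod_primes_power_dvd)
    show "p\<^sup>2 dvd m + 1" if "p \<in> P - A" for p
      using that pr[of p] prime_square_dvd_mult_SucD(2)[of p m] unfolding A_def by blast
    show "finite (P - A)"
      using fin by simp
    show "prime p" if "p \<in> P - A" for p
      using that pr(1)[of p] by simp
  qed
qed

text \<open>A union bound over e leaves N times the sum of \<open>1 / e^2\<close> over
  \<open>e > v\<close>. Only \<open>e \<le> N\<close> can occur because
  \<open>e \<le> e^2 \<le> m\<close>.\<close>

lemma card_large_square_divisor_le:
  fixes N v :: nat
  assumes v: "v > 0"
  shows "real (card {m \<in> {1..N}. \<exists>e>v. e\<^sup>2 dvd m}) \<le> 2 * real N / real v"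
proof -
  have "{m \<in> {1..N}. \<exists>e>v. e\<^sup>2 dvd m} \<subseteq> (\<Union>e\<in>{v<..N}. {m \<in> {1..N}. e\<^sup>2 dvd m})"
  proof
    fix m assume "m \<in> {m \<in> {1..N}. \<exists>e>v. e\<^sup>2 dvd m}"
    then obtain e where e: "m \<in> {1..N}" "v < e" "e\<^sup>2 dvd m"
      by auto
    have "e \<le> e\<^sup>2"
      by (cases e) (auto simp: power2_eq_square)
    also have "\<dots> \<le> N"
      using e dvd_imp_le[of "e\<^sup>2" m] by auto
    finally show "m \<in> (\<Union>e\<in>{v<..N}. {m \<in> {1..N}. e\<^sup>2 dvd m})"
      using e by auto
  qed
  then have "card {m \<in> {1..N}. \<exists>e>v. e\<^sup>2 dvd m} \<le> card (\<Union>e\<in>{v<..N}. {m \<in> {1..N}. e\<^sup>2 dvd m})"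
    by (intro card_mono) auto
  also have "\<dots> \<le> (\<Sum>e\<in>{v<..N}. card {m \<in> {1..N}. e\<^sup>2 dvd m})"
    by (intro card_UN_le) auto
  finally have "real (card {m \<in> {1..N}. \<exists>e>v. e\<^sup>2 dvd m}) \<le> (\<Sum>e\<in>{v<..N}. real (card {m \<in> {1..N}. e\<^sup>2 dvd m}))"
    by (metis (mono_tags, lifting) of_nat_le_iff of_nat_sum sum.cong)
  \<comment> \<open>The exponent is written \<open>0 - 2\<close> to match the tail estimate at
    \<open>\<eta> = 0\<close>.\<close>
  also have "\<dots> \<le> (\<Sum>e\<in>{v<..N}. real N * real e powr (0 - 2))"
  proof (intro sum_mono)
    fix e assume "e \<in> {v<..N}"
    then show "real (card {m \<in> {1..N}. e\<^sup>2 dvd m}) \<le> real N * real e powr (0 - 2)"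
      using card_multiples_le[of "e\<^sup>2" N] by (simp add: powr_minus_divide)
  qed
  also have "\<dots> = real N * (\<Sum>e\<in>{v<..N}. real e powr (0 - 2))"
    by (simp add: sum_distrib_left)
  also have "\<dots> \<le> real N * (2 * real v powr (0 - 1))"
    using v by (intro mult_left_mono sum_powr_tail_le) auto
  also have "\<dots> = 2 * real N / real v"
    using v by (simp add: powr_minus_divide)
  finally show ?thesis .
qed

text \<open>A divisor d in \<open>{w<..v\<^sup>2}\<close> is counted by residue classes; if \<open>d > v\<^sup>2\<close>, then one of the
  coprime parts of d dividing m and \<open>m + 1\<close> exceeds v.\<close>

lemma card_sieve_tail_le:
  fixes M w v :: nat and C \<eta> :: real
  assumes C: "\<And>k. k > 0 \<Longrightarrow> 2 ^ omega k \<le> C * real k powr \<eta>" "C \<ge> 0"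
    and \<eta>: "0 \<le> \<eta>" "\<eta> \<le> 1 / 2" and w: "w > 0" and v: "v > 0"
  shows "real (card {m \<in> {1..M}. \<exists>d>w. squarefree d \<and> d\<^sup>2 dvd m * (m + 1)})
    \<le> 2 * C * real M * real w powr (\<eta> - 1) + C * (real v)\<^sup>2 powr (1 + \<eta>) + 6 * real (M + 1) / real v"
proof -
  define D where "D = {d \<in> {w<..v\<^sup>2}. squarefree d}"
  define A1 where "A1 = (\<Union>d\<in>D. {m \<in> {1..M}. d\<^sup>2 dvd m * (m + 1)})"
  define A2 where "A2 = {m \<in> {1..M}. \<exists>e>v. e\<^sup>2 dvd m}"
  define A3 where "A3 = {m \<in> {1..M}. \<exists>e>v. e\<^sup>2 dvd m + 1}"
  have "{m \<in> {1..M}. \<exists>d>w. squarefree d \<and> d\<^sup>2 dvd m * (m + 1)} \<subseteq> A1 \<union> (A2 \<union> A3)"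
  proof
    fix m assume "m \<in> {m \<in> {1..M}. \<exists>d>w. squarefree d \<and> d\<^sup>2 dvd m * (m + 1)}"
    then obtain d where m: "m \<in> {1..M}" and d: "w < d" "squarefree d" "d\<^sup>2 dvd m * (m + 1)"
      by auto
    show "m \<in> A1 \<union> (A2 \<union> A3)"
    proof (cases "d \<le> v\<^sup>2")
      case True
      then show ?thesis
        using m d by (auto simp: A1_def D_def)
    next
      case False
      obtain d1 d2 where d12: "d = d1 * d2" "d1\<^sup>2 dvd m" "d2\<^sup>2 dvd m + 1"
        using squarefree_square_dvd_mult_SucE[OF d(2,3)] .
      have "d1 > v \<or> d2 > v"
        using False mult_le_mono[of d1 v d2 v] unfolding d12(1) power2_eq_square by linarith
      then show ?thesis
        using m d12 by (auto simp: A2_def A3_def)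
    qed
  qed
  then have "card {m \<in> {1..M}. \<exists>d>w. squarefree d \<and> d\<^sup>2 dvd m * (m + 1)} \<le> card (A1 \<union> (A2 \<union> A3))"
    by (intro card_mono) (auto simp: A1_def A2_def A3_def D_def)
  also have "\<dots> \<le> card A1 + (card A2 + card A3)"
    using card_Un_le[of A1 "A2 \<union> A3"] card_Un_le[of A2 A3] by linarith
  finally have split: "real (card {m \<in> {1..M}. \<exists>d>w. squarefree d \<and> d\<^sup>2 dvd m * (m + 1)})
      \<le> real (card A1) + real (card A2) + real (card A3)"
    by linarith
  have "card A1 \<le> (\<Sum>d\<in>D. card {m \<in> {1..M}. d\<^sup>2 dvd m * (m + 1)})"
    unfolding A1_def by (intro card_UN_le) (auto simp: D_def)
  then have "real (card A1) \<le> (\<Sum>d\<in>D. real (card {m \<in> {1..M}. d\<^sup>2 dvd m * (m + 1)}))"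
    by (metis (mono_tags, lifting) of_nat_le_iff of_nat_sum sum.cong)
  \<comment> \<open>The second summand comes from the \<open>+ 1\<close> for each residue class,
    with d replaced by its upper bound \<open>v^2\<close>.\<close>
  also have "\<dots> \<le> (\<Sum>d\<in>D. C * real M * real d powr (\<eta> - 2) + C * (real v)\<^sup>2 powr \<eta>)"
  proof (intro sum_mono)
    fix d assume d: "d \<in> D"
    then have d0: "d > 0" and sq: "squarefree d" and dv: "d \<le> v\<^sup>2"
      by (auto simp: D_def)
    have dv': "real d \<le> (real v)\<^sup>2"
      using dv by (metis of_nat_le_iff of_nat_power)
    have "real (card {m \<in> {1..M}. d\<^sup>2 dvd m * (m + 1)}) \<le> 2 ^ omega d * (real M / (real d)\<^sup>2 + 1)"
      by (rule card_square_dvd_mult_Suc_le[OF sq])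
    also have "\<dots> \<le> (C * real d powr \<eta>) * (real M / (real d)\<^sup>2 + 1)"
      using C(1)[OF d0] by (intro mult_right_mono) auto
    also have "\<dots> = C * real M * real d powr (\<eta> - 2) + C * real d powr \<eta>"
      using d0 by (simp add: powr_diff powr_realpow algebra_simps)
    also have "\<dots> \<le> C * real M * real d powr (\<eta> - 2) + C * (real v)\<^sup>2 powr \<eta>"
      using dv' C(2) \<eta> by (intro add_left_mono mult_left_mono powr_mono2) auto
    finally show "real (card {m \<in> {1..M}. d\<^sup>2 dvd m * (m + 1)})
        \<le> C * real M * real d powr (\<eta> - 2) + C * (real v)\<^sup>2 powr \<eta>" .
  qed
  also have "\<dots> = C * real M * (\<Sum>d\<in>D. real d powr (\<eta> - 2)) + real (card D) * (C * (real v)\<^sup>2 powr \<eta>)"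
    by (simp add: sum.distrib sum_distrib_left)
  also have "\<dots> \<le> C * real M * (2 * real w powr (\<eta> - 1)) + (real v)\<^sup>2 * (C * (real v)\<^sup>2 powr \<eta>)"
  proof (intro add_mono mult_left_mono mult_right_mono sum_powr_tail_le w \<eta>)
    have "card D \<le> card {1..v\<^sup>2}"
      by (intro card_mono) (auto simp: D_def)
    then show "real (card D) \<le> (real v)\<^sup>2"
      by (metis card_atLeastAtMost diff_Suc_1 of_nat_le_iff of_nat_power)
  qed (use C(2) in \<open>auto simp: D_def\<close>)
  also have "(real v)\<^sup>2 * (C * (real v)\<^sup>2 powr \<eta>) = C * (real v)\<^sup>2 powr (1 + \<eta>)"
    using v by (simp add: powr_add)
  finally have 1: "real (card A1) \<le> 2 * C * real M * real w powr (\<eta> - 1) + C * (real v)\<^sup>2 powr (1 + \<eta>)"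
    by (simp add: mult_ac)
  have "real (card A2) \<le> 2 * real M / real v"
    unfolding A2_def by (rule card_large_square_divisor_le[OF v])
  moreover have "real (card A3) \<le> 2 * real (M + 1) / real v"
  proof -
    have "card A3 \<le> card {m \<in> {1..M + 1}. \<exists>e>v. e\<^sup>2 dvd m}"
      by (rule card_inj_on_le[of Suc]) (auto simp: A3_def)
    then show ?thesis
      using card_large_square_divisor_le[OF v, of "M + 1"] by linarith
  qed
  moreover have "2 * real M / real v + 2 * real (M + 1) / real v \<le> 6 * real (M + 1) / real v"
    by (simp add: field_simps flip: add_divide_distrib) (simp add: divide_right_mono)
  ultimately show ?thesis
    using split 1 by linarith
qed

section \<open>The asymptotic formula\<close>

text \<open>The terms dropped from the Moebius identity have \<open>d > w\<close>. There are at most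
  \<open>2 ^ omega k\<close> of them, each of absolute value at most 1, and there are none unless
  such a d exists.\<close>

lemma sieve_truncation:
  fixes k w :: nat
  assumes k: "k > 0"
  shows "\<bar>of_bool (squarefree k) - (\<Sum>d\<in>{1..w}. real_of_int (moebius_mu d) * of_bool (d\<^sup>2 dvd k))\<bar>
    \<le> 2 ^ omega k * of_bool (\<exists>d>w. squarefree d \<and> d\<^sup>2 dvd k)"
proof -
  define D where "D = {d. squarefree d \<and> d\<^sup>2 dvd k}"
  have fin: "finite D" and card: "card D \<le> 2 ^ omega k"
    unfolding D_def by (rule finite_squarefree_square_divisors[OF k], rule card_squarefree_square_divisors_le[OF k])
  have D0: "0 \<notin> D"
    by (auto simp: D_def)
  have "of_bool (squarefree k) = real_of_int (\<Sum>d\<in>D. moebius_mu d)"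
    unfolding D_def sum_moebius_mu_square_divisors[OF k] by simp
  also have "\<dots> = (\<Sum>d\<in>D. real_of_int (moebius_mu d))"
    by simp
  also have "\<dots> = (\<Sum>d\<in>D \<inter> {1..w}. real_of_int (moebius_mu d)) + (\<Sum>d\<in>D - {1..w}. real_of_int (moebius_mu d))"
    using fin by (rule sum.Int_Diff)
  also have "(\<Sum>d\<in>D \<inter> {1..w}. real_of_int (moebius_mu d))
      = (\<Sum>d\<in>{1..w}. real_of_int (moebius_mu d) * of_bool (d\<^sup>2 dvd k))"
    by (rule sum.mono_neutral_cong_left) (auto simp: D_def moebius_mu_def)
  finally have eq: "of_bool (squarefree k) - (\<Sum>d\<in>{1..w}. real_of_int (moebius_mu d) * of_bool (d\<^sup>2 dvd k))
      = (\<Sum>d\<in>D - {1..w}. real_of_int (moebius_mu d))"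
    by simp
  have large: "d > w" if "d \<in> D - {1..w}" for d
    using that D0 by (cases "d = 0") auto
  show ?thesis
  proof (cases "D - {1..w} = {}")
    case True
    show ?thesis
      unfolding eq True by simp
  next
    case False
    then obtain d where "d \<in> D - {1..w}"
      by blast
    then have "\<exists>d>w. squarefree d \<and> d\<^sup>2 dvd k"
      using large[of d] by (auto simp: D_def)
    moreover have "\<bar>\<Sum>d\<in>D - {1..w}. real_of_int (moebius_mu d)\<bar> \<le> 2 ^ omega k"
    proof -
      have "card (D - {1..w}) \<le> 2 ^ omega k"
        using card card_mono[OF fin, of "D - {1..w}"] by auto
      then have "real (card (D - {1..w})) \<le> 2 ^ omega k"
        by (metis of_nat_le_iff of_nat_numeral of_nat_power)
      moreover have "\<bar>\<Sum>d\<in>D - {1..w}. real_of_int (moebius_mu d)\<bar> \<le> (\<Sum>d\<in>D - {1..w}. 1)"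
        by (rule order_trans[OF sum_abs]) (intro sum_mono abs_moebius_mu_le)
      ultimately show ?thesis
        by (simp only: sum_constant mult_1_right)
    qed
    ultimately show ?thesis
      unfolding eq by simp
  qed
qed

lemma S_eq_sum_squarefree:
  "S c X = (\<Sum>n\<in>dyadic X. of_bool (squarefree (nat \<lfloor>real n powr c\<rfloor> * (nat \<lfloor>real n powr c\<rfloor> + 1))))"
proof -
  have "(moebius_mu m)\<^sup>2 * (moebius_mu (m + 1))\<^sup>2 = of_bool (squarefree (m * (m + 1)))" for m
    unfolding squarefree_mult_Suc_iff by (simp add: moebius_mu_def flip: power_mult)
  then show ?thesis
    unfolding S_def dyadic_def by simp
qed

text \<open>The derivative of \<open>x powr c\<close> is at least 1 for \<open>x \<ge> 1\<close>, so
  consecutive values are at least 1 apart and have different floors. The resulting injectivity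
  allows counting m in place of n.\<close>

lemma strict_mono_on_floor_powr:
  assumes "c \<ge> 1"
  shows "strict_mono_on {1..} (\<lambda>n. nat \<lfloor>real n powr c\<rfloor>)"
proof (rule strict_mono_onI)
  fix n n' :: nat assume n: "n \<in> {1..}" "n' \<in> {1..}" "n < n'"
  have pos: "0 < real n" "real n \<le> real n'"
    using n by auto
  obtain z where z: "real n \<le> z" "real n' powr c - real n powr c = (real n' - real n) * (c * z powr (c - 1))"
    by (rule powr_mean_value[OF pos])
  have "1 \<le> z powr (c - 1)"
    using z(1) n assms by (intro ge_one_powr_ge_zero) auto
  then have "1 \<le> c * z powr (c - 1)"
    using assms mult_mono[of 1 c 1 "z powr (c - 1)"] by simp
  then have "1 \<le> (real n' - real n) * (c * z powr (c - 1))"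
    using n mult_mono[of 1 "real n' - real n" 1 "c * z powr (c - 1)"] by simp
  then have "real n powr c + 1 \<le> real n' powr c"
    using z(2) by linarith
  moreover have "0 \<le> real n powr c"
    by simp
  ultimately show "nat \<lfloor>real n powr c\<rfloor> < nat \<lfloor>real n' powr c\<rfloor>"
    by linarith
qed

text \<open>Here w is the cutoff for d and v the auxiliary cutoff in the tail count. The four
  contributions are the tail \<open>d > w\<close>, the errors in the residue classes for
  \<open>d \<le> w\<close>, the rounding of the number of n to \<open>X / 2\<close>, and the
  truncation of the series for \<open>sigma_const\<close>.\<close>

lemma S_explicit_bound:
  fixes c X C \<eta> :: real and w v :: nat
  assumes c: "1 < c" "c < 7 / 6" and X: "X \<ge> 54 ^ 4"
    and C: "\<And>k. k > 0 \<Longrightarrow> 2 ^ omega k \<le> C * real k powr \<eta>" "C \<ge> 0"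
    and \<eta>: "0 \<le> \<eta>" "\<eta> \<le> 1 / 2" and w: "w > 0" and v: "v > 0"
    and wX: "real w \<le> X powr (c / 4 - 1 / 8)"
  shows "\<bar>S c X - 1 / 2 * sigma_const * X\<bar> \<le>
    C * (2 * (X powr c)\<^sup>2) powr \<eta> * (2 * C * X powr c * real w powr (\<eta> - 1)
      + C * (real v)\<^sup>2 powr (1 + \<eta>) + 12 * X powr c / real v)
    + C * real w powr (1 + \<eta>) * (2 * (10 / (c - 1) + 140) * (X powr (c / 2 + 1 / 4) * (1 + ln X)))
    + (\<bar>sigma_const\<bar> + 2 * C) + X * (C * real w powr (\<eta> - 1))"
proof -
  define m where "m n = nat \<lfloor>real n powr c\<rfloor>" for n :: nat
  define M where "M = nat \<lfloor>X powr c\<rfloor>"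
  define E where "E = 2 * (10 / (c - 1) + 140) * (X powr (c / 2 + 1 / 4) * (1 + ln X))"
  define N where "N = real (card (dyadic X))"
  define T where "T = (\<Sum>d\<in>{1..w}. real_of_int (moebius_mu d) * real (card {n \<in> dyadic X. d\<^sup>2 dvd m n * (m n + 1)}))"
  define bad where "bad k \<longleftrightarrow> (\<exists>d>w. squarefree d \<and> d\<^sup>2 dvd k)" for k :: nat
  have X1: "X \<ge> 1"
    using X by simp
  have fin: "finite (dyadic X)"
    using X1 by (intro finite_dyadic) simp
  have Xc: "X powr c \<ge> 1"
    using X1 c by (intro ge_one_powr_ge_zero) auto
  have M: "M \<ge> 1" "real M \<le> X powr c"
    using Xc unfolding M_def by (auto simp: le_nat_floor)
  have E0: "E \<ge> 0"
    using c X1 by (auto simp: E_def)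
  have m_range: "m n \<in> {1..M}" if "n \<in> dyadic X" for n
  proof -
    have "1 \<le> real n" "real n \<le> X"
      using that by (auto simp: dyadic_def)
    then have "1 \<le> real n powr c" "real n powr c \<le> X powr c"
      using c by (auto intro: ge_one_powr_ge_zero powr_mono2)
    then show ?thesis
      unfolding m_def M_def by (auto simp: le_nat_floor intro!: nat_mono floor_mono)
  qed
  have m_pos: "m n > 0" if "n \<in> dyadic X" for n
    using m_range[OF that] by simp
  have inj: "inj_on m (dyadic X)"
    unfolding m_def using c
    by (intro inj_on_subset[OF strict_mono_on_imp_inj_on[OF strict_mono_on_floor_powr]]) (auto simp: dyadic_def)

  have "S c X - T = (\<Sum>n\<in>dyadic X. of_bool (squarefree (m n * (m n + 1)))
      - (\<Sum>d\<in>{1..w}. real_of_int (moebius_mu d) * of_bool (d\<^sup>2 dvd m n * (m n + 1))))"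
  proof -
    have "T = (\<Sum>d\<in>{1..w}. \<Sum>n\<in>dyadic X. real_of_int (moebius_mu d) * of_bool (d\<^sup>2 dvd m n * (m n + 1)))"
      unfolding T_def using fin by (intro sum.cong refl) (simp add: sum_distrib_left[symmetric] sum.If_cases Int_def of_bool_def)
    also have "\<dots> = (\<Sum>n\<in>dyadic X. \<Sum>d\<in>{1..w}. real_of_int (moebius_mu d) * of_bool (d\<^sup>2 dvd m n * (m n + 1)))"
      by (rule sum.swap)
    finally show ?thesis
      unfolding S_eq_sum_squarefree m_def[symmetric] by (simp add: sum_subtractf)
  qed
  also have "\<bar>\<dots>\<bar> \<le> (\<Sum>n\<in>dyadic X. C * (2 * (X powr c)\<^sup>2) powr \<eta> * of_bool (bad (m n * (m n + 1))))"
  proof (rule order_trans[OF sum_abs], intro sum_mono)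
    fix n assume n: "n \<in> dyadic X"
    define k where "k = m n * (m n + 1)"
    have k: "k > 0"
      using m_pos[OF n] by (simp add: k_def)
    have "real (m n) \<le> X powr c"
      using m_range[OF n] M by (meson atLeastAtMost_iff of_nat_le_iff order_trans)
    then have "real (m n) * (real (m n) + 1) \<le> X powr c * (X powr c + X powr c)"
      using Xc by (intro mult_mono add_mono) auto
    then have "real k \<le> 2 * (X powr c)\<^sup>2"
      by (simp add: k_def power2_eq_square algebra_simps)
    then have "C * real k powr \<eta> \<le> C * (2 * (X powr c)\<^sup>2) powr \<eta>"
      using C(2) \<eta> by (intro mult_left_mono powr_mono2) auto
    then have "2 ^ omega k \<le> C * (2 * (X powr c)\<^sup>2) powr \<eta>"
      using C(1)[OF k] by (rule order_trans[rotated])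
    then have "2 ^ omega k * of_bool (bad k) \<le> C * (2 * (X powr c)\<^sup>2) powr \<eta> * of_bool (bad k)"
      by (intro mult_right_mono) auto
    with sieve_truncation[OF k, of w]
    show "\<bar>of_bool (squarefree (m n * (m n + 1))) - (\<Sum>d\<in>{1..w}. real_of_int (moebius_mu d) * of_bool (d\<^sup>2 dvd m n * (m n + 1)))\<bar>
        \<le> C * (2 * (X powr c)\<^sup>2) powr \<eta> * of_bool (bad (m n * (m n + 1)))"
      unfolding k_def[symmetric] bad_def[symmetric] by (rule order_trans)
  qed
  also have "\<dots> = C * (2 * (X powr c)\<^sup>2) powr \<eta> * real (card {n \<in> dyadic X. bad (m n * (m n + 1))})"
    using fin by (simp add: sum_distrib_left[symmetric] sum.If_cases Int_def of_bool_def)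
  also have "\<dots> \<le> C * (2 * (X powr c)\<^sup>2) powr \<eta> * (2 * C * X powr c * real w powr (\<eta> - 1)
      + C * (real v)\<^sup>2 powr (1 + \<eta>) + 12 * X powr c / real v)"
  proof (intro mult_left_mono)
    \<comment> \<open>Here the special form of the values is given up: by injectivity the count is
      at most that over all m up to M.\<close>
    have "card {n \<in> dyadic X. bad (m n * (m n + 1))} \<le> card {m \<in> {1..M}. bad (m * (m + 1))}"
      using inj m_range by (intro card_inj_on_le[of m]) (auto intro: inj_on_subset)
    then have "real (card {n \<in> dyadic X. bad (m n * (m n + 1))})
        \<le> 2 * C * real M * real w powr (\<eta> - 1) + C * (real v)\<^sup>2 powr (1 + \<eta>) + 6 * real (M + 1) / real v"
      using card_sieve_tail_le[OF C \<eta> w v, of M] unfolding bad_def by linarith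
    also have "\<dots> \<le> 2 * C * X powr c * real w powr (\<eta> - 1) + C * (real v)\<^sup>2 powr (1 + \<eta>) + 12 * X powr c / real v"
      using M(2) Xc C(2) by (intro add_mono mult_right_mono mult_left_mono divide_right_mono) auto
    finally show "real (card {n \<in> dyadic X. bad (m n * (m n + 1))})
        \<le> 2 * C * X powr c * real w powr (\<eta> - 1) + C * (real v)\<^sup>2 powr (1 + \<eta>) + 12 * X powr c / real v" .
  qed (use C(2) in auto)
  finally have 1: "\<bar>S c X - T\<bar> \<le> C * (2 * (X powr c)\<^sup>2) powr \<eta> * (2 * C * X powr c * real w powr (\<eta> - 1)
      + C * (real v)\<^sup>2 powr (1 + \<eta>) + 12 * X powr c / real v)" .

  have "T - N * (\<Sum>d\<in>{1..w}. sieve_coeff d)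
      = (\<Sum>d\<in>{1..w}. real_of_int (moebius_mu d) *
          (real (card {n \<in> dyadic X. d\<^sup>2 dvd m n * (m n + 1)}) - 2 ^ omega d * (N / (real d)\<^sup>2)))"
    unfolding T_def sieve_coeff_def by (simp add: sum_distrib_left sum_subtractf algebra_simps)
  also have "\<bar>\<dots>\<bar> \<le> (\<Sum>d\<in>{1..w}. C * real w powr \<eta> * E)"
  proof (rule order_trans[OF sum_abs], intro sum_mono)
    fix d assume d: "d \<in> {1..w}"
    show "\<bar>real_of_int (moebius_mu d) *
          (real (card {n \<in> dyadic X. d\<^sup>2 dvd m n * (m n + 1)}) - 2 ^ omega d * (N / (real d)\<^sup>2))\<bar>
        \<le> C * real w powr \<eta> * E"
    proof (cases "squarefree d")
      case False
      then show ?thesis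
        using C(2) E0 by (simp add: moebius_mu_def)
    next
      case True
      have d0: "d > 0"
        using d by simp
      have q: "real (d\<^sup>2) \<le> X powr (c / 2 - 1 / 4)"
      proof -
        have "real d \<le> X powr (c / 4 - 1 / 8)"
          using d wX by (meson atLeastAtMost_iff of_nat_le_iff order_trans)
        then have "real d * real d \<le> X powr (c / 4 - 1 / 8) * X powr (c / 4 - 1 / 8)"
          by (intro mult_mono) auto
        also have "\<dots> = X powr (c / 2 - 1 / 4)"
          by (simp flip: powr_add)
        finally show ?thesis
          by (simp add: power2_eq_square)
      qed
      have "real (card {n \<in> dyadic X. d\<^sup>2 dvd m n * (m n + 1)})
          = (\<Sum>n\<in>dyadic X. of_bool (d\<^sup>2 dvd m n * (m n + 1)))"
        using fin by (simp add: sum.If_cases Int_def of_bool_def)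
      also have "\<dots> = (\<Sum>n\<in>dyadic X. \<Sum>b\<in>sq_roots d. of_bool ([m n = b] (mod d\<^sup>2)))"
        by (intro sum.cong refl of_bool_square_dvd_mult_Suc d0)
      also have "\<dots> = (\<Sum>b\<in>sq_roots d. \<Sum>n\<in>dyadic X. of_bool ([m n = b] (mod d\<^sup>2)))"
        by (rule sum.swap)
      also have "\<dots> = (\<Sum>b\<in>sq_roots d. real (card {n \<in> dyadic X. [m n = b] (mod d\<^sup>2)}))"
        using fin by (intro sum.cong refl) (simp add: sum.If_cases Int_def of_bool_def)
      finally have "real (card {n \<in> dyadic X. d\<^sup>2 dvd m n * (m n + 1)}) - 2 ^ omega d * (N / (real d)\<^sup>2)
          = (\<Sum>b\<in>sq_roots d. real (card {n \<in> dyadic X. [m n = b] (mod d\<^sup>2)}) - N / real (d\<^sup>2))"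
        by (simp add: sum_subtractf card_sq_roots[OF True])
      also have "\<bar>\<dots>\<bar> \<le> (\<Sum>b\<in>sq_roots d. E)"
        unfolding m_def N_def E_def using d0 q
        by (intro order_trans[OF sum_abs] sum_mono card_floor_powr_cong c X) auto
      also have "\<dots> = 2 ^ omega d * E"
        by (simp add: card_sq_roots[OF True])
      also have "\<dots> \<le> C * real d powr \<eta> * E"
        using C(1)[OF d0] E0 by (intro mult_right_mono) auto
      also have "\<dots> \<le> C * real w powr \<eta> * E"
        using d C(2) E0 \<eta> by (intro mult_right_mono mult_left_mono powr_mono2) auto
      finally have "\<bar>real (card {n \<in> dyadic X. d\<^sup>2 dvd m n * (m n + 1)}) - 2 ^ omega d * (N / (real d)\<^sup>2)\<bar>
          \<le> C * real w powr \<eta> * E" .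
      then show ?thesis
        unfolding abs_mult
        by (intro order_trans[OF mult_right_mono[OF abs_moebius_mu_le abs_ge_zero]]) simp
    qed
  qed
  also have "\<dots> = C * real w powr (1 + \<eta>) * E"
    using w by (simp add: powr_add)
  finally have 2: "\<bar>T - N * (\<Sum>d\<in>{1..w}. sieve_coeff d)\<bar> \<le> C * real w powr (1 + \<eta>) * E" .

  define R where "R = (\<Sum>d\<in>{1..w}. sieve_coeff d) - sigma_const"
  have R: "\<bar>R\<bar> \<le> 2 * C * real w powr (\<eta> - 1)"
    using sigma_const_approx[OF C \<eta>(2) w] unfolding R_def by linarith
  have "real w powr (\<eta> - 1) \<le> 1"
    using w \<eta> powr_mono[of "\<eta> - 1" 0 "real w"] by simp
  then have R': "\<bar>R\<bar> \<le> 2 * C"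
    using R C(2) mult_left_mono[of "real w powr (\<eta> - 1)" 1 "2 * C"] by linarith
  \<comment> \<open>The split pairs \<open>N - X / 2\<close>, of absolute value at most 1, with a
    bounded factor, while \<open>X / 2\<close> meets only the truncation error R.\<close>
  have "N * (\<Sum>d\<in>{1..w}. sieve_coeff d) - 1 / 2 * sigma_const * X = (N - X / 2) * (sigma_const + R) + X / 2 * R"
    unfolding R_def by (simp add: algebra_simps)
  also have "\<bar>\<dots>\<bar> \<le> 1 * (\<bar>sigma_const\<bar> + 2 * C) + X / 2 * (2 * C * real w powr (\<eta> - 1))"
  proof (rule order_trans[OF abs_triangle_ineq], unfold abs_mult, intro add_mono mult_mono)
    show "\<bar>N - X / 2\<bar> \<le> 1"
      unfolding N_def using X1 by (intro card_dyadic) simp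
    show "\<bar>sigma_const + R\<bar> \<le> \<bar>sigma_const\<bar> + 2 * C"
      using R' by linarith
  qed (use R X1 in auto)
  finally have 3: "\<bar>N * (\<Sum>d\<in>{1..w}. sieve_coeff d) - 1 / 2 * sigma_const * X\<bar>
      \<le> (\<bar>sigma_const\<bar> + 2 * C) + X * (C * real w powr (\<eta> - 1))"
    by simp
  have "\<bar>a - e\<bar> \<le> p + q + r + s" if "\<bar>a - b\<bar> \<le> p" "\<bar>b - d\<bar> \<le> q" "\<bar>d - e\<bar> \<le> r + s"
    for a b d e p q r s :: real
    using that by linarith
  from this[OF 1 2 3] show ?thesis
    unfolding E_def .
qed

theorem theorem1:
  fixes c :: real
  assumes "1 < c" and "c < 7 / 6"
  shows "\<forall>\<epsilon>::real. \<epsilon> > 0 \<longrightarrow>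
    (\<lambda>X::real. S c X - 1 / 2 * sigma_const * X) \<in> O[at_top](\<lambda>X. X powr ((6 * c + 1) / 8 + \<epsilon>))"
proof (intro allI impI)
  fix \<epsilon> :: real assume \<epsilon>: "\<epsilon> > 0"
  \<comment> \<open>The tail for \<open>d > w\<close> carries \<open>X powr (4 * \<eta>)\<close>:
    three from the divisor bound and one from the tail count, whence \<open>\<epsilon> / 4\<close>.
    The cap \<open>1 / 2\<close> is required by the tail sums.\<close>
  define \<eta> where "\<eta> = min (\<epsilon> / 4) (1 / 2)"
  define \<theta> where "\<theta> = (6 * c + 1) / 8"
  \<comment> \<open>\<open>a = c - \<theta>\<close>, and \<open>2 * a = c / 2 - 1 / 4\<close> is the
    exponent of the largest modulus \<open>d^2\<close>.\<close>
  define a where "a = c / 4 - 1 / 8"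
  define K where "K = 2 * (10 / (c - 1) + 140)"
  have \<eta>: "0 < \<eta>" "\<eta> \<le> 1 / 2" "4 * \<eta> \<le> \<epsilon>"
    using \<epsilon> by (auto simp: \<eta>_def)
  obtain C where C: "C \<ge> 1" "\<And>k. k > 0 \<Longrightarrow> 2 ^ omega k \<le> C * real k powr \<eta>"
    by (rule omega_le_powr[OF \<eta>(1)]) blast
  have C0: "C \<ge> 0"
    using C(1) by simp
  have a: "0 < a" "a \<le> 1"
    using assms by (auto simp: a_def)
  \<comment> \<open>The condition \<open>c < 7 / 6\<close> is equivalent to
    \<open>\<theta> < 1\<close>; below, this bounds \<open>\<theta> * \<eta>\<close> by
    \<open>\<eta>\<close>.\<close>
  have \<theta>: "\<theta> \<le> 1"
    using assms by (simp add: \<theta>_def)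
  have K0: "K \<ge> 0"
    using assms by (simp add: K_def)
  \<comment> \<open>One summand for each of the bounds \<open>b1\<close> to \<open>b4\<close>
    below.\<close>
  define B where "B = 2 * C * (4 * C + C + 24) + C * K * (1 + 1 / \<eta>) + (\<bar>sigma_const\<bar> + 2 * C) + 2 * C"
  have "\<bar>S c X - 1 / 2 * sigma_const * X\<bar> \<le> B * X powr (\<theta> + \<epsilon>)" if X: "X \<ge> 54 ^ 4" for X
  proof -
    define w where "w = nat \<lfloor>X powr a\<rfloor>"
    \<comment> \<open>This makes \<open>v^2\<close> about \<open>X powr \<theta>\<close>, while
      \<open>X powr c / v\<close> stays within a constant of \<open>X powr \<theta>\<close> because
      \<open>c \<le> 3 * \<theta> / 2\<close>.\<close>
    define v where "v = nat \<lfloor>X powr (\<theta> / 2)\<rfloor>"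
    have X1: "X \<ge> 1"
      using X by simp
    have floor_half: "0 < nat \<lfloor>t\<rfloor>" "real (nat \<lfloor>t\<rfloor>) \<le> t" "t / 2 \<le> real (nat \<lfloor>t\<rfloor>)" if "t \<ge> 1" for t :: real
    proof -
      have "1 \<le> \<lfloor>t\<rfloor>"
        using that by simp
      then show "0 < nat \<lfloor>t\<rfloor>" "real (nat \<lfloor>t\<rfloor>) \<le> t" "t / 2 \<le> real (nat \<lfloor>t\<rfloor>)"
        by linarith+
    qed
    have "X powr a \<ge> 1" "X powr (\<theta> / 2) \<ge> 1"
      using X1 a assms by (auto intro!: ge_one_powr_ge_zero simp: \<theta>_def)
    then have w: "0 < w" "real w \<le> X powr a" "X powr a / 2 \<le> real w"
      and v: "0 < v" "real v \<le> X powr (\<theta> / 2)" "X powr (\<theta> / 2) / 2 \<le> real v"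
      unfolding w_def v_def by (simp_all only: floor_half)
    have mono: "X powr p \<le> X powr q" if "p \<le> q" for p q
      using that X1 by (rule powr_mono)
    have a\<eta>: "a * \<eta> \<le> \<eta>" "0 \<le> a * \<eta>"
      using a \<eta> mult_right_mono[of a 1 \<eta>] by auto
    \<comment> \<open>The exponent is negative, so it is the lower bound for w that matters;
      rounding costs \<open>2 powr (1 - \<eta>) \<le> 2\<close>.\<close>
    have w_neg: "real w powr (\<eta> - 1) \<le> 2 * X powr (\<eta> - a)"
    proof -
      have "real w powr (\<eta> - 1) \<le> (X powr a / 2) powr (\<eta> - 1)"
        using w \<eta> X1 by (intro powr_mono2') auto
      also have "\<dots> = X powr (a * (\<eta> - 1)) * 2 powr (1 - \<eta>)"
        using X1 by (simp add: powr_divide powr_powr powr_diff field_simps)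
      also have "\<dots> \<le> X powr (\<eta> - a) * 2 powr 1"
        using a\<eta> \<eta> by (intro mult_mono mono powr_mono) (auto simp: algebra_simps)
      finally show ?thesis
        by simp
    qed
    have t1: "(2 * (X powr c)\<^sup>2) powr \<eta> \<le> 2 * X powr (3 * \<eta>)"
    proof -
      have "(2 * (X powr c)\<^sup>2) powr \<eta> = 2 powr \<eta> * X powr (2 * c * \<eta>)"
        using X1 by (simp add: powr_mult powr_powr power2_eq_square flip: powr_add)
      \<comment> \<open>This uses \<open>2 * c \<le> 3\<close>.\<close>
      also have "\<dots> \<le> 2 powr 1 * X powr (3 * \<eta>)"
        using \<eta> assms by (intro mult_mono mono powr_mono mult_right_mono) auto
      finally show ?thesis
        by simp
    qed
    have t2: "X powr c * real w powr (\<eta> - 1) \<le> 2 * X powr (\<theta> + \<eta>)"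
    proof -
      have "X powr c * real w powr (\<eta> - 1) \<le> X powr c * (2 * X powr (\<eta> - a))"
        using w_neg by (intro mult_left_mono) auto
      also have "\<dots> = 2 * X powr (\<theta> + \<eta>)"
        by (simp add: \<theta>_def a_def field_simps flip: powr_add)
      finally show ?thesis .
    qed
    have t3: "(real v)\<^sup>2 powr (1 + \<eta>) \<le> X powr (\<theta> + \<eta>)"
    proof -
      have "(real v)\<^sup>2 \<le> (X powr (\<theta> / 2))\<^sup>2"
        using v by (intro power_mono) auto
      also have "\<dots> = X powr \<theta>"
        by (simp add: power2_eq_square flip: powr_add)
      finally have "(real v)\<^sup>2 powr (1 + \<eta>) \<le> (X powr \<theta>) powr (1 + \<eta>)"
        using \<eta> by (intro powr_mono2) auto
      also have "\<dots> = X powr (\<theta> * (1 + \<eta>))"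
        by (simp add: powr_powr)
      also have "\<dots> \<le> X powr (\<theta> + \<eta>)"
        using \<eta> mult_right_mono[OF \<theta>, of \<eta>] by (intro mono) (simp add: algebra_simps)
      finally show ?thesis .
    qed
    have t4: "X powr c / real v \<le> 2 * X powr (\<theta> + \<eta>)"
    proof -
      have "X powr c / real v \<le> X powr c / (X powr (\<theta> / 2) / 2)"
        using v X1 by (intro divide_left_mono) auto
      also have "\<dots> = 2 * X powr (c - \<theta> / 2)"
        by (simp add: powr_diff)
      also have "\<dots> \<le> 2 * X powr (\<theta> + \<eta>)"
        using \<eta> assms by (intro mult_left_mono mono) (auto simp: \<theta>_def field_simps)
      finally show ?thesis .
    qed
    have "C * (2 * (X powr c)\<^sup>2) powr \<eta> * (2 * C * X powr c * real w powr (\<eta> - 1)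
        + C * (real v)\<^sup>2 powr (1 + \<eta>) + 12 * X powr c / real v)
      \<le> C * (2 * X powr (3 * \<eta>)) * (4 * C * X powr (\<theta> + \<eta>) + C * X powr (\<theta> + \<eta>) + 24 * X powr (\<theta> + \<eta>))"
    proof (rule mult_mono)
      show "C * (2 * (X powr c)\<^sup>2) powr \<eta> \<le> C * (2 * X powr (3 * \<eta>))"
        by (intro mult_left_mono t1 C0)
      have "2 * C * X powr c * real w powr (\<eta> - 1) \<le> 4 * C * X powr (\<theta> + \<eta>)"
        using mult_left_mono[OF t2, of "2 * C"] C0 by (simp add: mult_ac)
      moreover have "C * (real v)\<^sup>2 powr (1 + \<eta>) \<le> C * X powr (\<theta> + \<eta>)"
        by (intro mult_left_mono t3 C0)
      moreover have "12 * X powr c / real v \<le> 24 * X powr (\<theta> + \<eta>)"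
        using t4 by simp
      ultimately show "2 * C * X powr c * real w powr (\<eta> - 1) + C * (real v)\<^sup>2 powr (1 + \<eta>)
          + 12 * X powr c / real v
        \<le> 4 * C * X powr (\<theta> + \<eta>) + C * X powr (\<theta> + \<eta>) + 24 * X powr (\<theta> + \<eta>)"
        by (intro add_mono)
    qed (use C0 in auto)
    also have "\<dots> = 2 * C * (4 * C + C + 24) * (X powr (3 * \<eta>) * X powr (\<theta> + \<eta>))"
      by (simp add: algebra_simps)
    also have "X powr (3 * \<eta>) * X powr (\<theta> + \<eta>) = X powr (\<theta> + 4 * \<eta>)"
      by (simp add: algebra_simps flip: powr_add)
    also have "2 * C * (4 * C + C + 24) * X powr (\<theta> + 4 * \<eta>) \<le> 2 * C * (4 * C + C + 24) * X powr (\<theta> + \<epsilon>)"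
      using \<eta> C0 by (intro mult_left_mono mono) auto
    finally have b1: "C * (2 * (X powr c)\<^sup>2) powr \<eta> * (2 * C * X powr c * real w powr (\<eta> - 1)
        + C * (real v)\<^sup>2 powr (1 + \<eta>) + 12 * X powr c / real v)
      \<le> 2 * C * (4 * C + C + 24) * X powr (\<theta> + \<epsilon>)" .
    have lnX: "1 + ln X \<le> (1 + 1 / \<eta>) * X powr \<eta>"
      using ln_powr_bound[OF X1 \<eta>(1)] ge_one_powr_ge_zero[OF X1, of \<eta>] \<eta>(1)
      by (simp add: algebra_simps)
    have "C * real w powr (1 + \<eta>) * (K * (X powr (c / 2 + 1 / 4) * (1 + ln X)))
        \<le> C * (X powr a) powr (1 + \<eta>) * (K * (X powr (c / 2 + 1 / 4) * ((1 + 1 / \<eta>) * X powr \<eta>)))"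
      using w C0 K0 \<eta> X1 by (intro mult_mono mult_left_mono powr_mono2 lnX) auto
    also have "\<dots> = C * K * (1 + 1 / \<eta>) * ((X powr a) powr (1 + \<eta>) * (X powr (c / 2 + 1 / 4) * X powr \<eta>))"
      by simp
    also have "(X powr a) powr (1 + \<eta>) * (X powr (c / 2 + 1 / 4) * X powr \<eta>) = X powr (\<theta> + a * \<eta> + \<eta>)"
    proof -
      \<comment> \<open>Up to multiples of \<open>\<eta>\<close> this is
        \<open>a + c / 2 + 1 / 4 = \<theta>\<close>. Together with \<open>c - a = \<theta>\<close>
        it shows that the errors from small and large d balance at this a.\<close>
      have "a * (1 + \<eta>) + (c / 2 + 1 / 4 + \<eta>) = \<theta> + a * \<eta> + \<eta>"
        by (simp add: \<theta>_def a_def field_simps)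
      then show ?thesis
        unfolding powr_powr powr_add[symmetric] by (simp only:)
    qed
    also have "C * K * (1 + 1 / \<eta>) * X powr (\<theta> + a * \<eta> + \<eta>) \<le> C * K * (1 + 1 / \<eta>) * X powr (\<theta> + \<epsilon>)"
    proof (intro mult_left_mono mono)
      show "\<theta> + a * \<eta> + \<eta> \<le> \<theta> + \<epsilon>"
        using \<eta> a\<eta> by linarith
    qed (use \<eta> C0 K0 in auto)
    finally have b2: "C * real w powr (1 + \<eta>) * (K * (X powr (c / 2 + 1 / 4) * (1 + ln X)))
        \<le> C * K * (1 + 1 / \<eta>) * X powr (\<theta> + \<epsilon>)" .
    have "1 \<le> X powr (\<theta> + \<epsilon>)"
      using X1 assms \<epsilon> by (intro ge_one_powr_ge_zero) (auto simp: \<theta>_def)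
    then have b3: "\<bar>sigma_const\<bar> + 2 * C \<le> (\<bar>sigma_const\<bar> + 2 * C) * X powr (\<theta> + \<epsilon>)"
      using C0 mult_left_mono[of 1 "X powr (\<theta> + \<epsilon>)" "\<bar>sigma_const\<bar> + 2 * C"] by simp
    have "X * (C * real w powr (\<eta> - 1)) \<le> X * (C * (2 * X powr (\<eta> - a)))"
      using w_neg C0 X1 by (intro mult_left_mono) auto
    also have "\<dots> = 2 * C * (X powr 1 * X powr (\<eta> - a))"
      using X1 by simp
    also have "\<dots> = 2 * C * X powr (1 + (\<eta> - a))"
      by (simp only: powr_add)
    \<comment> \<open>Here \<open>1 - a \<le> \<theta>\<close> amounts to \<open>c \<ge> 1\<close>:
      completing the series costs no more than the other errors.\<close>
    also have "\<dots> \<le> 2 * C * X powr (\<theta> + \<epsilon>)"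
      using \<eta> C0 assms by (intro mult_left_mono mono) (auto simp: \<theta>_def a_def field_simps)
    finally have b4: "X * (C * real w powr (\<eta> - 1)) \<le> 2 * C * X powr (\<theta> + \<epsilon>)" .
    have "\<bar>S c X - 1 / 2 * sigma_const * X\<bar> \<le>
      C * (2 * (X powr c)\<^sup>2) powr \<eta> * (2 * C * X powr c * real w powr (\<eta> - 1)
        + C * (real v)\<^sup>2 powr (1 + \<eta>) + 12 * X powr c / real v)
      + C * real w powr (1 + \<eta>) * (K * (X powr (c / 2 + 1 / 4) * (1 + ln X)))
      + (\<bar>sigma_const\<bar> + 2 * C) + X * (C * real w powr (\<eta> - 1))"
      unfolding K_def using \<eta>(1) w(2)
      by (intro S_explicit_bound[OF assms X C(2) C0 _ \<eta>(2) w(1) v(1)]) (simp_all only: a_def less_imp_le)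
    also have "\<dots> \<le> 2 * C * (4 * C + C + 24) * X powr (\<theta> + \<epsilon>) + C * K * (1 + 1 / \<eta>) * X powr (\<theta> + \<epsilon>)
      + (\<bar>sigma_const\<bar> + 2 * C) * X powr (\<theta> + \<epsilon>) + 2 * C * X powr (\<theta> + \<epsilon>)"
      by (intro add_mono b1 b2 b3 b4)
    also have "\<dots> = B * X powr (\<theta> + \<epsilon>)"
      unfolding B_def by (simp only: distrib_right)
    finally show ?thesis .
  qed
  then have "\<forall>\<^sub>F X in at_top. norm (S c X - 1 / 2 * sigma_const * X) \<le> B * norm (X powr (\<theta> + \<epsilon>))"
    by (intro eventually_mono[OF eventually_ge_at_top[of "54 ^ 4"]]) simp
  then show "(\<lambda>X::real. S c X - 1 / 2 * sigma_const * X) \<in> O[at_top](\<lambda>X. X powr ((6 * c + 1) / 8 + \<epsilon>))"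
    unfolding \<theta>_def by (rule bigoI)
qed

end
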